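(* Let $N\ge2$, $1\le p<\infty$, let $T_1=B_{w_1},\dots,T_N=B_{w_N}$ be unilateral weighted shifts on $\ell^p(\mathbb{N})$, and let $\mathcal{A}=\mathcal{A}_{uBd}$ or $\mathcal{A}=\mathcal{A}_{ud}$. Then $T_1,\dots,T_N$ are disjoint $\mathcal{A}$-hypercyclic if and only if: (1) for any $j\ge1$ and any $s\in[N]$, $\sum_{n\ge1}\frac{1}{|W^s_{j,n}|^p}<\infty$; (2) for any $l\ge1$, any scalars $(a_{s,j})_{s\in[N],j\in[l]}$ with all $a_{s,j}\ne0$, and any $\varepsilon>0$, there exists $A\in\mathcal{A}$ such that for any $s\ne t\in[N]$ and any $n\in A$: (a) for any $j\in[l]$, $\displaystyle\sum_{m\in A:\ m>n}\frac{|W^s_{j+m-n,n}|^p}{|W^t_{j,m}|^p}\le\varepsilon$; (b) for any $j\in[l]$, $\displaystyle\left|\frac{W^s_{j,n}}{W^t_{j,n}}-\frac{a_{s,j}}{a_{t,j}}\right|\le\varepsilon$. Here $W^s_{l,n}=\prod_{\nu=1}^nw_{s,l+\nu}$ for all $s\in[N]$.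
   Context: $\mathbb{N}=\{1,2,\dots\}$, $[l]=\{1,\dots,l\}$; spaces are over $\mathbb{K}=\mathbb{R}$ or $\mathbb{C}$ with canonical basis $(e_n)_{n\ge1}$. For a bounded weight sequence $w=(w_n)_{n\ge1}$ of scalars, the unilateral weighted (backward) shift is $B_w(e_1)=0$, $B_w(e_n)=w_ne_{n-1}$ for $n\ge2$. We write $w_s=(w_{s,n})_{n\ge1}$. For $A\subset\mathbb{N}$: $\overline{\mathrm{dens}}\,A=\limsup_{M\to\infty}\frac{\mathrm{card}\{n\le M:n\in A\}}{M}$, $\overline{\mathrm{Bd}}\,A=\limsup_{M\to\infty}\max_{k\ge1}\frac{\mathrm{card}(A\cap\{k+1,\dots,k+M\})}{M}$. $\mathcal{A}_{uBd}$ and $\mathcal{A}_{ud}$ are the families of subsets of $\mathbb{N}$ of positive upper Banach density and positive upper density, respectively. $T_1,\dots,T_N$ are disjoint $\mathcal{A}$-hypercyclic if there is $x\in X$ (here $X=\ell^p(\mathbb{N})$) such that for all non-empty open $V_1,\dots,V_N\subset X$, $\{n:T_s^nx\in V_s\text{ for all }s\in[N]\}\in\mathcal{A}$. Convention: $1/0=+\infty$, so condition (1) includes the requirement that all $W^s_{j,n}$ are nonzero. *)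

theory Defs
  imports "HOL-Analysis.Analysis"
begin

text \<open>
  Sequences indexed by the positive integers are functions on \<^typ>\<open>nat\<close>. For elements of
  \<open>\<ell>\<^sup>p\<close> the entry at the unused index \<open>0\<close> is pinned to \<open>0\<close>, so that equality of functions is
  equality of sequences; for weight sequences it is ignored. The scalar field is a type of sort
  \<open>{real_normed_field, euclidean_space}\<close>: its instances are \<^typ>\<open>real\<close> and \<^typ>\<open>complex\<close>, up to
  isometric isomorphism of real algebras (Frobenius).
\<close>

subsection \<open>The space \<open>\<ell>\<^sup>p\<close>\<close>

definition lp :: "real \<Rightarrow> (nat \<Rightarrow> 'a::real_normed_field) set" where
  "lp p = {x. x 0 = 0 \<and> (\<lambda>n. norm (x n) powr p) summable_on {1..}}"

definition lp_norm :: "real \<Rightarrow> (nat \<Rightarrow> 'a::real_normed_field) \<Rightarrow> real" where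
  "lp_norm p x = (\<Sum>\<^sub>\<infinity>n\<in>{1..}. norm (x n) powr p) powr (1 / p)"

definition lp_dist :: "real \<Rightarrow> (nat \<Rightarrow> 'a::real_normed_field) \<Rightarrow> (nat \<Rightarrow> 'a) \<Rightarrow> real" where
  "lp_dist p x y = lp_norm p (\<lambda>n. x n - y n)"

definition lp_topology :: "real \<Rightarrow> (nat \<Rightarrow> 'a::real_normed_field) topology" where
  "lp_topology p = Metric_space.mtopology (lp p) (lp_dist p)"

lemma powr_add_le_weighted:
  fixes u v A B p :: real
  assumes "0 \<le> u" "0 \<le> v" "0 < A" "0 < B" "1 \<le> p"
  shows "(u + v) powr p \<le> (A + B) powr (p - 1) * (u powr p / A powr (p - 1) + v powr p / B powr (p - 1))"
proof -
  define l where "l = A / (A + B)"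
  have l: "0 < l" "l < 1" "1 - l = B / (A + B)"
    using assms by (auto simp: l_def field_simps)
  have contract: "(c * t) powr p \<le> c * t powr p" if "0 < c" "c < 1" "0 \<le> t" for c t :: real
  proof -
    have "c powr p \<le> c powr 1"
      using that assms by (intro powr_mono') auto
    then show ?thesis
      using that by (simp add: powr_mult mult_right_mono)
  qed
  have conv: "(l * s + (1 - l) * t) powr p \<le> l * s powr p + (1 - l) * t powr p"
    if "0 \<le> s" "0 \<le> t" for s t :: real
  proof (cases "s = 0 \<or> t = 0")
    case True
    then show ?thesis
      using contract[of l s] contract[of "1 - l" t] that l(1,2) by auto
  next
    case False
    then have "s \<in> {0<..}" "t \<in> {0<..}"
      using that by auto
    from convex_onD[OF powr_convex[OF assms(5)], of "1 - l" s t] this l(1,2) show ?thesis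
      by simp
  qed
  have scale: "C / (A + B) * (t * (A + B) / C) powr p = (A + B) powr (p - 1) * (t powr p / C powr (p - 1))"
    if "0 < C" "0 \<le> t" for C t :: real
  proof -
    have "(t * (A + B) / C) powr p = t powr p * (A + B) powr p / C powr p"
      using that assms by (simp add: powr_mult powr_divide)
    then show ?thesis
      using that assms by (simp add: powr_diff)
  qed
  have "l * (u * (A + B) / A) + (1 - l) * (v * (A + B) / B) = u + v"
    using assms unfolding l(3) by (simp add: l_def)
  then show ?thesis
    using conv[of "u * (A + B) / A" "v * (A + B) / B"] scale[of A u] scale[of B v] assms
    unfolding l(3) by (simp add: l_def distrib_left)
qed

lemma lp_add_le:
  fixes x y :: "nat \<Rightarrow> 'a::real_normed_field"
  assumes p: "1 \<le> p" and x: "x \<in> lp p" and y: "y \<in> lp p"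
  shows "(\<lambda>n. x n + y n) \<in> lp p" and "lp_norm p (\<lambda>n. x n + y n) \<le> lp_norm p x + lp_norm p y"
proof -
  let ?X = "\<Sum>\<^sub>\<infinity>n\<in>{1..}. norm (x n) powr p" and ?Y = "\<Sum>\<^sub>\<infinity>n\<in>{1..}. norm (y n) powr p"
  let ?Z = "\<Sum>\<^sub>\<infinity>n\<in>{1..}. norm (x n + y n) powr p"
  have sx: "(\<lambda>n. norm (x n) powr p) summable_on {1..}" and sy: "(\<lambda>n. norm (y n) powr p) summable_on {1..}"
    using x y by (auto simp: lp_def)
  have main: "(\<lambda>n. norm (x n + y n) powr p) summable_on {1..} \<and>
      ?Z \<le> (A + B) powr (p - 1) * (?X / A powr (p - 1) + ?Y / B powr (p - 1))"
    if AB: "0 < A" "0 < B" for A B :: real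
  proof -
    let ?g = "\<lambda>n. (A + B) powr (p - 1) *
      (norm (x n) powr p * (1 / A powr (p - 1)) + norm (y n) powr p * (1 / B powr (p - 1)))"
    have le: "norm (x n + y n) powr p \<le> ?g n" for n
    proof -
      have "norm (x n + y n) powr p \<le> (norm (x n) + norm (y n)) powr p"
        using p by (intro powr_mono2 norm_triangle_ineq) auto
      also have "\<dots> \<le> ?g n"
        using powr_add_le_weighted[OF _ _ AB p, of "norm (x n)" "norm (y n)"] by simp
      finally show ?thesis .
    qed
    have "(?g has_sum (A + B) powr (p - 1) * (?X * (1 / A powr (p - 1)) + ?Y * (1 / B powr (p - 1)))) {1..}"
      by (intro has_sum_cmult_right has_sum_add has_sum_cmult_left has_sum_infsum sx sy)
    then have g: "?g summable_on {1..}"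
      and gs: "infsum ?g {1..} = (A + B) powr (p - 1) * (?X * (1 / A powr (p - 1)) + ?Y * (1 / B powr (p - 1)))"
      by (auto simp: summable_on_def infsumI)
    have s: "(\<lambda>n. norm (x n + y n) powr p) summable_on {1..}"
      by (rule summable_on_comparison_test[OF g]) (use le in auto)
    have "?Z \<le> infsum ?g {1..}"
      by (rule infsum_mono[OF s g le])
    with s gs show ?thesis
      by simp
  qed
  show "(\<lambda>n. x n + y n) \<in> lp p"
    using main[of 1 1] x y by (auto simp: lp_def)
  have nn: "0 \<le> ?X" "0 \<le> ?Y" "0 \<le> ?Z"
    by (auto intro: infsum_nonneg)
  have pow: "lp_norm p x powr p = ?X" "lp_norm p y powr p = ?Y"
    using nn p by (auto simp: lp_norm_def powr_powr)
  have nonneg: "0 \<le> lp_norm p x" "0 \<le> lp_norm p y"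
    by (auto simp: lp_norm_def)
  show "lp_norm p (\<lambda>n. x n + y n) \<le> lp_norm p x + lp_norm p y"
  proof (rule field_le_epsilon)
    fix e :: real assume e: "0 < e"
    define A B where "A = lp_norm p x + e / 2" and "B = lp_norm p y + e / 2"
    have AB: "0 < A" "0 < B"
      using e nonneg by (auto simp: A_def B_def)
    have "?X \<le> A powr p" "?Y \<le> B powr p"
      unfolding pow[symmetric] using p e nonneg by (auto intro!: powr_mono2 simp: A_def B_def)
    then have "?X / A powr (p - 1) \<le> A" "?Y / B powr (p - 1) \<le> B"
      using AB by (auto simp: powr_diff field_simps)
    then have "?Z \<le> (A + B) powr (p - 1) * (A + B)"
      using main[OF AB] by (smt (verit) mult_left_mono powr_ge_zero)
    also have "\<dots> = (A + B) powr p"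
      using AB by (simp add: powr_diff)
    finally have "?Z powr (1 / p) \<le> ((A + B) powr p) powr (1 / p)"
      using nn p by (intro powr_mono2) auto
    also have "\<dots> = A + B"
      using AB p by (simp add: powr_powr)
    finally show "lp_norm p (\<lambda>n. x n + y n) \<le> lp_norm p x + lp_norm p y + e"
      by (simp add: lp_norm_def A_def B_def)
  qed
qed

lemma lp_diff_closed:
  fixes x y :: "nat \<Rightarrow> 'a::real_normed_field"
  assumes "1 \<le> p" "x \<in> lp p" "y \<in> lp p"
  shows "(\<lambda>n. x n - y n) \<in> lp p"
  using lp_add_le(1)[of p x "\<lambda>n. - y n"] assms by (simp add: lp_def)

lemma Metric_space_lp:
  assumes p: "1 \<le> p"
  shows "Metric_space (lp p :: (nat \<Rightarrow> 'a::real_normed_field) set) (lp_dist p)"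
proof
  fix x y z :: "nat \<Rightarrow> 'a"
  show "0 \<le> lp_dist p x y"
    by (simp add: lp_dist_def lp_norm_def)
  show "lp_dist p x y = lp_dist p y x"
    by (simp add: lp_dist_def lp_norm_def norm_minus_commute)
  assume xy: "x \<in> lp p" "y \<in> lp p"
  have s: "(\<lambda>n. norm (x n - y n) powr p) summable_on {1..}"
    using lp_diff_closed[OF p xy] by (simp add: lp_def)
  show "lp_dist p x y = 0 \<longleftrightarrow> x = y"
  proof
    assume "lp_dist p x y = 0"
    then have "(\<Sum>\<^sub>\<infinity>n\<in>{1..}. norm (x n - y n) powr p) = 0"
      using p by (simp add: lp_dist_def lp_norm_def)
    then have "norm (x n - y n) powr p = 0" if "n \<in> {1..}" for n
      using nonneg_infsum_le_0D[OF _ s _ that] by simp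
    then have "x n = y n" if "n \<ge> 1" for n
      using that by auto
    moreover have "x 0 = y 0"
      using xy by (simp add: lp_def)
    ultimately show "x = y"
      by (metis ext less_one not_le)
  qed (simp add: lp_dist_def lp_norm_def)
  assume z: "z \<in> lp p"
  show "lp_dist p x z \<le> lp_dist p x y + lp_dist p y z"
    using lp_add_le(2)[OF p lp_diff_closed[OF p xy] lp_diff_closed[OF p xy(2) z]]
    by (simp add: lp_dist_def)
qed

lemma topspace_lp: "1 \<le> p \<Longrightarrow> topspace (lp_topology p) = lp p"
  by (simp add: lp_topology_def Metric_space.topspace_mtopology Metric_space_lp)


subsection \<open>Weighted shifts\<close>

definition weighted_shift :: "(nat \<Rightarrow> 'a::real_normed_field) \<Rightarrow> (nat \<Rightarrow> 'a) \<Rightarrow> nat \<Rightarrow> 'a" where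
  "weighted_shift w x n = (if n = 0 then 0 else w (n + 1) * x (n + 1))"

definition canonical_basis :: "nat \<Rightarrow> nat \<Rightarrow> 'a::real_normed_field" where
  "canonical_basis n = (\<lambda>k. if k = n then 1 else 0)"

lemma weighted_shift_basis_1: "weighted_shift w (canonical_basis 1) = (\<lambda>_. 0)"
  by (auto simp: weighted_shift_def canonical_basis_def)

lemma weighted_shift_basis:
  "2 \<le> n \<Longrightarrow> weighted_shift w (canonical_basis n) = (\<lambda>k. w n * canonical_basis (n - 1) k)"
  by (rule ext) (auto simp: weighted_shift_def canonical_basis_def)

lemma weighted_shift_in_lp:
  fixes w x :: "nat \<Rightarrow> 'a::real_normed_field"
  assumes p: "1 \<le> p" and w: "bounded (w ` {1..})" and x: "x \<in> lp p"
  shows "weighted_shift w x \<in> lp p"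
proof -
  obtain C where C: "\<And>n. n \<ge> 1 \<Longrightarrow> norm (w n) \<le> C"
    using w by (force simp: bounded_iff)
  have "(\<lambda>n. norm (x n) powr p) summable_on Suc ` {1..}"
    by (rule summable_on_subset_banach) (use x in \<open>auto simp: lp_def\<close>)
  then have "(\<lambda>n. norm (x (Suc n)) powr p) summable_on {1..}"
    by (subst (asm) summable_on_reindex) (auto simp: o_def)
  then have "(\<lambda>n. C powr p * norm (x (Suc n)) powr p) summable_on {1..}"
    by (rule summable_on_cmult_right)
  then have "(\<lambda>n. norm (weighted_shift w x n) powr p) summable_on {1..}"
  proof (rule summable_on_comparison_test)
    fix n :: nat assume "n \<in> {1..}"
    then show "norm (weighted_shift w x n) powr p \<le> C powr p * norm (x (Suc n)) powr p"
      using C[of "Suc n"] p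
      by (auto simp: weighted_shift_def norm_mult powr_mult intro!: mult_right_mono powr_mono2)
  qed auto
  then show ?thesis
    by (simp add: lp_def weighted_shift_def)
qed

definition weight_prod :: "(nat \<Rightarrow> 'a::real_normed_field) \<Rightarrow> nat \<Rightarrow> nat \<Rightarrow> 'a" where
  "weight_prod w l n = (\<Prod>\<nu>=1..n. w (l + \<nu>))"


subsection \<open>Densities\<close>

definition upper_density :: "nat set \<Rightarrow> ereal" where
  "upper_density A = limsup (\<lambda>M. ereal (real (card {n \<in> A. 1 \<le> n \<and> n \<le> M}) / real M))"

text \<open>The maximum over \<open>k\<close> exists: the cardinalities are integers between \<open>0\<close> and \<open>M\<close>.\<close>

definition upper_Banach_density :: "nat set \<Rightarrow> ereal" where
  "upper_Banach_density A =
     limsup (\<lambda>M. ereal (real (MAX k\<in>{1..}. card (A \<inter> {k+1..k+M})) / real M))"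

lemma finite_window_cards: "finite ((\<lambda>k. card (A \<inter> {k+1..k+M})) ` {1::nat..})"
proof (rule finite_subset)
  show "(\<lambda>k. card (A \<inter> {k+1..k+M})) ` {1..} \<subseteq> {..M}"
  proof clarsimp
    fix k
    have "card (A \<inter> {Suc k..k+M}) \<le> card {Suc k..k+M}"
      by (rule card_mono) auto
    then show "card (A \<inter> {Suc k..k+M}) \<le> M"
      by simp
  qed
qed simp

definition family_ud :: "nat set set" where
  "family_ud = {A. A \<subseteq> {1..} \<and> upper_density A > 0}"

definition family_uBd :: "nat set set" where
  "family_uBd = {A. A \<subseteq> {1..} \<and> upper_Banach_density A > 0}"


subsection \<open>Disjoint hypercyclicity\<close>

definition disjoint_hypercyclic ::
    "nat set set \<Rightarrow> 'x topology \<Rightarrow> nat \<Rightarrow> (nat \<Rightarrow> 'x \<Rightarrow> 'x) \<Rightarrow> bool" where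
  "disjoint_hypercyclic \<A> X N T \<longleftrightarrow>
     (\<exists>x\<in>topspace X. \<forall>V. (\<forall>s\<in>{1..N}. openin X (V s) \<and> V s \<noteq> {}) \<longrightarrow>
        {n. 1 \<le> n \<and> (\<forall>s\<in>{1..N}. (T s ^^ n) x \<in> V s)} \<in> \<A>)"

end

theory Submission
  imports Defs "HOL-Complex_Analysis.Great_Picard"
begin

text \<open>
  The \<open>n\<close>-th iterate of a weighted shift reads \<open>(T\<^sub>s\<^sup>n x)\<^sub>j = W\<^sup>s\<^sub>j\<^sub>,\<^sub>n x\<^sub>j\<^sub>+\<^sub>n\<close>, so every statement about orbits is a
  statement about the single sequence \<open>x\<close> and the products of weights. Positive upper density and
  positive upper Banach density are treated at once: both say that for some \<open>\<delta> > 0\<close> there are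
  arbitrarily long windows \<open>{k+1..k+M}\<close> that contain at least \<open>\<delta> M\<close> points of the set, where the
  offset \<open>k\<close> ranges over \<open>{0}\<close> or over all positive integers. Only this property, called
  \<open>window_dense\<close>, is used.

  Necessity. Let \<open>A\<close> be the set of times at which every \<open>T\<^sub>s\<^sup>n x\<close> is close to a finitely supported
  target \<open>y\<^sub>s\<close>. For \<open>n < m\<close> in \<open>A\<close> the entry of \<open>T\<^sub>s\<^sup>n x\<close> at \<open>j + m - n\<close> is \<open>W\<^sup>s\<^sub>j\<^sub>+\<^sub>m\<^sub>-\<^sub>n\<^sub>,\<^sub>n x\<^sub>j\<^sub>+\<^sub>m\<close>. It
  is small, whereas \<open>\<bar>x\<^sub>j\<^sub>+\<^sub>m\<bar>\<close> is comparable to \<open>1 / \<bar>W\<^sup>t\<^sub>j\<^sub>,\<^sub>m\<bar>\<close> because \<open>m\<close> is a return time of \<open>T\<^sub>t\<close>. Summing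
  over \<open>m\<close> gives the first part of the comparison condition, once \<open>A\<close> is thinned to a residue
  class so that \<open>j + m - n\<close> leaves the support of the target; dividing the \<open>j\<close>-th entries of
  \<open>T\<^sub>s\<^sup>n x\<close> and \<open>T\<^sub>t\<^sup>n x\<close> gives the second part. For \<open>s = t\<close> and the target \<open>e\<^sub>j\<close> the same computation
  bounds \<open>\<Sum> 1 / \<bar>W\<^sup>s\<^sub>j\<^sub>,\<^sub>m\<^sub>-\<^sub>n\<bar>\<^sup>p\<close> over \<open>m \<in> A\<close>, \<open>m > n\<close>, uniformly in \<open>n \<in> A\<close>. That the full series
  converges is then a recurrence fact (\<open>summable_of_difference_sums\<close>): on average over \<open>n\<close> the
  differences \<open>m - n\<close> fill a set that meets every upward translate of some finite set, and the inverse
  products decrease at most geometrically along such a translation.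

  Sufficiency. For each of countably many targets, given by finitely many nonzero coefficients and
  a tolerance, the hypotheses yield a set \<open>B\<close> of admissible return times
  (\<open>single_target_return_set\<close>). Finite pieces \<open>E\<^sub>i\<close> of these sets are then placed one after the other
  in such a way that every target is served infinitely often, each time in a window at least as long
  as its index and with the proportion of points that \<open>B\<close> allows (\<open>separated_windows\<close>). The vector
  \<open>x\<close> carries at position \<open>m + j\<close>, for \<open>m \<in> E\<^sub>i\<close>, the number \<open>a\<^sub>1\<^sub>j / W\<^sup>1\<^sub>j\<^sub>,\<^sub>m\<close>, so that \<open>T\<^sub>1\<^sup>m x\<close> shows the
  entry \<open>a\<^sub>1\<^sub>j\<close> exactly and the other \<open>T\<^sub>s\<^sup>m x\<close> show \<open>a\<^sub>s\<^sub>j\<close> approximately. At a time \<open>n \<in> E\<^sub>i\<close> earlier pieces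
  have been shifted away, the rest of the same piece is controlled by the comparison condition, and
  later pieces start so far out that the convergent series absorbs the factor \<open>C\<^sup>n\<close> by which \<open>n\<close>
  shifts with weights bounded by \<open>C\<close> can enlarge them (\<open>vector_from_windows\<close>). Upper densities are
  what permits this: they are tested along windows that may be chosen as sparse and as far out as
  desired, so the sets that belong to different targets never have to be compared with each other.
\<close>

section \<open>Sets with a positive proportion of points in long windows\<close>

text \<open>
  The set \<open>Os\<close> of admitted offsets is a parameter so that one notion covers both families: \<open>{0}\<close>
  gives the initial segments that define upper density, \<open>{1..}\<close> the sliding windows that define
  upper Banach density. The constant \<open>\<delta>\<close> is kept explicit, rather than hidden in a limit superior,
  because the construction of a hypercyclic vector copies finite windows together with their \<open>\<delta>\<close>.
\<close>

definition window_dense :: "nat set \<Rightarrow> nat set \<Rightarrow> bool" where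
  "window_dense Os A \<longleftrightarrow> A \<subseteq> {1..} \<and>
     (\<exists>\<delta>>0. \<forall>K. \<exists>M\<ge>K. \<exists>k\<in>Os. \<delta> * real M \<le> real (card (A \<inter> {k+1..k+M})))"

lemma limsup_pos_iff:
  fixes u :: "nat \<Rightarrow> real"
  shows "0 < limsup (\<lambda>M. ereal (u M)) \<longleftrightarrow> (\<exists>\<delta>>0. \<forall>K. \<exists>M\<ge>K. \<delta> \<le> u M)"
proof
  assume "0 < limsup (\<lambda>M. ereal (u M))"
  then obtain d where d: "0 < ereal d" "ereal d < limsup (\<lambda>M. ereal (u M))"
    using ereal_dense2 by blast
  have "\<exists>M\<ge>K. d \<le> u M" for K
  proof (rule ccontr)
    assume "\<not> (\<exists>M\<ge>K. d \<le> u M)"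
    then have "\<forall>\<^sub>F M in sequentially. ereal (u M) \<le> ereal d"
      by (auto simp: eventually_sequentially intro!: exI[of _ K])
    then have "limsup (\<lambda>M. ereal (u M)) \<le> ereal d"
      by (rule Limsup_bounded)
    with d show False by simp
  qed
  with d show "\<exists>\<delta>>0. \<forall>K. \<exists>M\<ge>K. \<delta> \<le> u M" by auto
next
  assume "\<exists>\<delta>>0. \<forall>K. \<exists>M\<ge>K. \<delta> \<le> u M"
  then obtain d where d: "d > 0" "\<And>K. \<exists>M\<ge>K. d \<le> u M" by blast
  have "ereal d \<le> limsup (\<lambda>M. ereal (u M))"
    unfolding limsup_INF_SUP
  proof (rule INF_greatest)
    fix K :: nat
    obtain M where "M \<ge> K" "d \<le> u M" using d by blast
    then show "ereal d \<le> (SUP m\<in>{K..}. ereal (u m))"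
      by (intro SUP_upper2[of M]) auto
  qed
  with d show "0 < limsup (\<lambda>M. ereal (u M))"
    by (metis ereal_less(2) order_less_le_trans)
qed

lemma ratio_frequently_iff:
  fixes c :: "nat \<Rightarrow> nat"
  shows "(\<exists>\<delta>>0. \<forall>K. \<exists>M\<ge>K. \<delta> \<le> real (c M) / real M) \<longleftrightarrow>
    (\<exists>\<delta>>0. \<forall>K. \<exists>M\<ge>K. \<delta> * real M \<le> real (c M))"
proof -
  have "(\<forall>K. \<exists>M\<ge>K. d \<le> real (c M) / real M) \<longleftrightarrow> (\<forall>K. \<exists>M\<ge>K. d * real M \<le> real (c M))"
    if d: "d > 0" for d :: real
  proof -
    have eq: "d \<le> real (c M) / real M \<longleftrightarrow> d * real M \<le> real (c M)" if "M \<ge> 1" for M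
      using that by (simp add: field_simps)
    have shift: "(\<forall>K. \<exists>M\<ge>K. Q M) \<longleftrightarrow> (\<forall>K\<ge>1. \<exists>M\<ge>K. Q M)" for Q :: "nat \<Rightarrow> bool"
      by (meson le_add1 le_add2 order_trans)
    show ?thesis
      by (subst (1 2) shift) (meson eq order_trans)
  qed
  then show ?thesis by blast
qed

lemma family_ud_eq_window_dense: "family_ud = {A. window_dense {0} A}"
proof -
  have "{n \<in> A. 1 \<le> n \<and> n \<le> M} = A \<inter> {0+1..0+M}" for A :: "nat set" and M by auto
  then show ?thesis
    by (auto simp only: family_ud_def upper_density_def limsup_pos_iff ratio_frequently_iff
        window_dense_def singleton_iff bex_simps simp_thms mem_Collect_eq)
qed

lemma family_uBd_eq_window_dense: "family_uBd = {A. window_dense {1..} A}"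
proof -
  have "d * real M \<le> real (MAX k\<in>{1..}. card (A \<inter> {k+1..k+M})) \<longleftrightarrow>
      (\<exists>k\<in>{1..}. d * real M \<le> real (card (A \<inter> {k+1..k+M})))" for d A and M :: nat
  proof
    let ?S = "(\<lambda>k. card (A \<inter> {k+1..k+M})) ` {1..}"
    have "Max ?S \<in> ?S"
      using finite_window_cards by (intro Max_in) auto
    then show "d * real M \<le> real (Max ?S) \<Longrightarrow> (\<exists>k\<in>{1..}. d * real M \<le> real (card (A \<inter> {k+1..k+M})))"
      by force
    show "(\<exists>k\<in>{1..}. d * real M \<le> real (card (A \<inter> {k+1..k+M}))) \<Longrightarrow> d * real M \<le> real (Max ?S)"
      using Max_ge[OF finite_window_cards[of A M]] by (meson imageI of_nat_mono order_trans)
  qed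
  then show ?thesis
    by (auto simp only: family_uBd_def upper_Banach_density_def limsup_pos_iff ratio_frequently_iff
        window_dense_def mem_Collect_eq)
qed

lemma window_dense_mono:
  assumes "window_dense Os A" "A \<subseteq> B" "B \<subseteq> {1..}"
  shows "window_dense Os B"
proof -
  obtain \<delta> where \<delta>: "\<delta> > 0" "\<And>K. \<exists>M\<ge>K. \<exists>k\<in>Os. \<delta> * real M \<le> real (card (A \<inter> {k+1..k+M}))"
    using assms by (auto simp: window_dense_def)
  have "card (A \<inter> {k+1..k+M}) \<le> card (B \<inter> {k+1..k+M})" for k M
    using assms by (intro card_mono) auto
  then have "\<exists>M\<ge>K. \<exists>k\<in>Os. \<delta> * real M \<le> real (card (B \<inter> {k+1..k+M}))" for K
    by (meson \<delta>(2) of_nat_mono order_trans)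
  with \<delta>(1) assms(3) show ?thesis
    by (auto simp: window_dense_def)
qed

text \<open>
  If every piece had density below \<open>\<delta> / (card I + 1)\<close> in all long windows, then so would their
  union have density below \<open>\<delta>\<close>.
\<close>

lemma window_dense_partition:
  assumes A: "window_dense Os A" and I: "finite I" and cover: "A \<subseteq> (\<Union>i\<in>I. B i)"
  shows "\<exists>i\<in>I. window_dense Os (A \<inter> B i)"
proof (rule ccontr)
  assume neg: "\<not> (\<exists>i\<in>I. window_dense Os (A \<inter> B i))"
  obtain \<delta> where \<delta>: "\<delta> > 0" "\<And>K. \<exists>M\<ge>K. \<exists>k\<in>Os. \<delta> * real M \<le> real (card (A \<inter> {k+1..k+M}))"
    and A1: "A \<subseteq> {1..}"
    using A by (auto simp: window_dense_def)
  \<comment> \<open>Adding \<open>1\<close> makes the final inequality strict and covers the case of no pieces.\<close>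
  define \<eta> where "\<eta> = \<delta> / (real (card I) + 1)"
  have \<eta>: "\<eta> > 0" "real (card I) * \<eta> < \<delta>"
    using \<delta>(1) by (auto simp: \<eta>_def field_simps)
  have "\<exists>K. \<forall>M\<ge>K. \<forall>k\<in>Os. real (card (A \<inter> B i \<inter> {k+1..k+M})) < \<eta> * real M" if "i \<in> I" for i
    using neg that \<eta>(1) A1 unfolding window_dense_def by (meson inf.coboundedI1 not_le)
  then obtain K where K: "\<And>i M k. i \<in> I \<Longrightarrow> M \<ge> K i \<Longrightarrow> k \<in> Os \<Longrightarrow>
      real (card (A \<inter> B i \<inter> {k+1..k+M})) < \<eta> * real M"
    by metis
  obtain M k where M: "M \<ge> Max (insert 1 (K ` I))" "k \<in> Os" "\<delta> * real M \<le> real (card (A \<inter> {k+1..k+M}))"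
    using \<delta>(2) by blast
  have MK: "M \<ge> 1" "\<And>i. i \<in> I \<Longrightarrow> M \<ge> K i"
    using M(1) I by auto
  have "A \<inter> {k+1..k+M} = (\<Union>i\<in>I. A \<inter> B i \<inter> {k+1..k+M})"
    using cover by auto
  then have "card (A \<inter> {k+1..k+M}) \<le> (\<Sum>i\<in>I. card (A \<inter> B i \<inter> {k+1..k+M}))"
    using card_UN_le[OF I] by metis
  then have "real (card (A \<inter> {k+1..k+M})) \<le> (\<Sum>i\<in>I. real (card (A \<inter> B i \<inter> {k+1..k+M})))"
    by (metis of_nat_mono of_nat_sum)
  also have "\<dots> \<le> (\<Sum>i\<in>I. \<eta> * real M)"
    using K MK(2) M(2) by (intro sum_mono less_imp_le) auto
  also have "\<dots> < \<delta> * real M"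
    using \<eta>(2) MK(1) by simp
  finally show False
    using M(3) by simp
qed

text \<open>
  Some residue class modulo \<open>g\<close> meets \<open>A\<close> in a large set, and any two of its elements are at least
  \<open>g\<close> apart.
\<close>

lemma window_dense_thin:
  assumes A: "window_dense Os A" and g: "1 \<le> g"
  obtains B where "B \<subseteq> A" "window_dense Os B" "\<And>m n. m \<in> B \<Longrightarrow> n \<in> B \<Longrightarrow> n < m \<Longrightarrow> n + g \<le> m"
proof -
  have "A \<subseteq> (\<Union>r\<in>{..<g}. {n. n mod g = r})"
    using g by auto
  then obtain r where r: "window_dense Os (A \<inter> {n. n mod g = r})"
    using window_dense_partition[OF A finite_lessThan] by blast
  have "n + g \<le> m" if "m mod g = n mod g" "n < m" for m n :: nat
  proof -
    have "g dvd m - n"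
      using that by (metis mod_eq_dvd_iff_nat less_imp_le)
    then show ?thesis
      using that(2) by (auto dest!: dvd_imp_le)
  qed
  then show thesis
    using r by (intro that[of "A \<inter> {n. n mod g = r}"]) auto
qed

text \<open>
  Deleting the \<open>L\<close> first integers is harmless in windows of length at least \<open>2 L / \<delta>\<close>, and \<open>\<delta> / 2\<close>
  does not depend on \<open>L\<close>. This uniformity lets one choose ever later windows with a fixed proportion.
\<close>

lemma window_dense_beyond:
  assumes A: "window_dense Os A"
  obtains \<delta> where "\<delta> > 0"
    "\<And>K L. \<exists>M\<ge>K. \<exists>k\<in>Os. \<delta> * real M \<le> real (card (A \<inter> {L..} \<inter> {k+1..k+M}))"
proof -
  obtain \<delta> where \<delta>: "\<delta> > 0" "\<And>K. \<exists>M\<ge>K. \<exists>k\<in>Os. \<delta> * real M \<le> real (card (A \<inter> {k+1..k+M}))"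
    using A by (auto simp: window_dense_def)
  have "\<exists>M\<ge>K. \<exists>k\<in>Os. \<delta> / 2 * real M \<le> real (card (A \<inter> {L..} \<inter> {k+1..k+M}))" for K L
  proof -
    obtain M k where M: "M \<ge> max K (nat \<lceil>2 * real L / \<delta>\<rceil>)" "k \<in> Os" "\<delta> * real M \<le> real (card (A \<inter> {k+1..k+M}))"
      using \<delta>(2) by blast
    have "2 * real L / \<delta> \<le> real M"
      using M(1) by linarith
    then have "real L \<le> \<delta> / 2 * real M"
      using \<delta>(1) by (simp add: field_simps)
    moreover have "card (A \<inter> {k+1..k+M}) \<le> card ({..<L} \<union> A \<inter> {L..} \<inter> {k+1..k+M})"
      by (intro card_mono) auto
    then have "real (card (A \<inter> {k+1..k+M})) \<le> real L + real (card (A \<inter> {L..} \<inter> {k+1..k+M}))"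
      using card_Un_le[of "{..<L}" "A \<inter> {L..} \<inter> {k+1..k+M}"] by simp
    ultimately have "\<delta> / 2 * real M \<le> real (card (A \<inter> {L..} \<inter> {k+1..k+M}))"
      using M(3) by (simp add: field_simps)
    then show ?thesis
      using M(1,2) by auto
  qed
  then show thesis
    using that[of "\<delta> / 2"] \<delta>(1) by simp
qed

lemma window_dense_unbounded:
  assumes "window_dense Os A"
  obtains m where "m \<in> A" "L \<le> m"
proof -
  obtain \<delta> where \<delta>: "\<delta> > 0"
    "\<And>K L. \<exists>M\<ge>K. \<exists>k\<in>Os. \<delta> * real M \<le> real (card (A \<inter> {L..} \<inter> {k+1..k+M}))"
    using window_dense_beyond[OF assms] by metis
  obtain M k where M: "M \<ge> 1" "\<delta> * real M \<le> real (card (A \<inter> {L..} \<inter> {k+1..k+M}))"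
    using \<delta>(2)[of 1 L] by blast
  have "0 < \<delta> * real M"
    using \<delta>(1) M(1) by simp
  then have "A \<inter> {L..} \<inter> {k+1..k+M} \<noteq> {}"
    using M(2) by (intro notI) simp
  then show thesis
    using that by blast
qed

section \<open>Recurrence and summation over differences\<close>

text \<open>
  A Bonferroni inequality; replacing the number of pairs by \<open>r\<^sup>2\<close> keeps the induction linear.
\<close>

lemma card_UN_ge_pairwise:
  fixes X :: "nat \<Rightarrow> 'b set" and c e :: real
  assumes "\<And>i. i < r \<Longrightarrow> finite (X i)" "\<And>i. i < r \<Longrightarrow> c \<le> real (card (X i))"
    and "\<And>i j. i < j \<Longrightarrow> j < r \<Longrightarrow> real (card (X i \<inter> X j)) \<le> e" and "0 \<le> e"
  shows "real r * c - real r * real r * e \<le> real (card (\<Union>i<r. X i))"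
  using assms(1-3)
proof (induction r)
  case (Suc r)
  let ?U = "\<Union>i<r. X i"
  have IH: "real r * c - real r * real r * e \<le> real (card ?U)"
    using Suc by auto
  have fin: "finite ?U" "finite (X r)"
    using Suc.prems(1) by auto
  have "card (?U \<inter> X r) = card (\<Union>i<r. X i \<inter> X r)"
    by (rule arg_cong[of _ _ card]) auto
  also have "\<dots> \<le> (\<Sum>i<r. card (X i \<inter> X r))"
    by (rule card_UN_le) simp
  finally have "real (card (?U \<inter> X r)) \<le> (\<Sum>i<r. real (card (X i \<inter> X r)))"
    by (metis of_nat_mono of_nat_sum)
  also have "\<dots> \<le> (\<Sum>i<r. e)"
    using Suc.prems(3) by (intro sum_mono) auto
  finally have int: "real (card (?U \<inter> X r)) \<le> real r * e"
    by simp
  have "card ?U + card (X r) = card (?U \<union> X r) + card (?U \<inter> X r)"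
    by (rule card_Un_Int[OF fin])
  then have "real (card ?U) + real (card (X r)) = real (card (?U \<union> X r)) + real (card (?U \<inter> X r))"
    by linarith
  moreover have "?U \<union> X r = (\<Union>i<Suc r. X i)"
    by (auto simp: less_Suc_eq)
  moreover have "real r * e + real r * e + e \<ge> real r * e"
    using assms(4) by simp
  ultimately show ?case
    using IH int Suc.prems(2)[of r] by (simp add: algebra_simps)
qed simp

text \<open>
  Both points have to lie in the window, so that counting pairs by their first point or by their
  difference is an exchange of two finite sums.
\<close>

definition window_corr :: "nat set \<Rightarrow> nat \<Rightarrow> nat \<Rightarrow> nat \<Rightarrow> real" where
  "window_corr A k M h = real (card {n \<in> A \<inter> {k+1..k+M}. n + h \<in> A \<inter> {k+1..k+M}}) / real M"

text \<open>
  The translates of \<open>A \<inter> {k+1..k+M}\<close> by the elements of \<open>H\<close> all lie in a window of length \<open>2 M\<close>,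
  but there are \<open>r \<ge> 3 / \<delta>\<close> of them with at least \<open>\<delta> M\<close> elements each. They cannot be almost
  disjoint, and an overlap of two translates is a correlation at the difference of the shifts.
\<close>

lemma window_corr_large:
  assumes r: "3 \<le> real r * \<delta>" "0 < r" and dense: "\<delta> * real M \<le> real (card (A \<inter> {k+1..k+M}))"
    and H: "finite H" "card H = r" "\<And>h. h \<in> H \<Longrightarrow> h \<le> M" and M: "0 < M"
  shows "\<exists>h\<in>H. \<exists>h'\<in>H. h < h' \<and> 1 / (2 * real r * real r) \<le> window_corr A k M (h' - h)"
proof (rule ccontr)
  assume neg: "\<not> ?thesis"
  define B where "B = A \<inter> {k+1..k+M}"
  define e where "e = 1 / (2 * real r * real r)"
  have e: "e > 0" using r by (simp add: e_def)
  obtain f where f: "bij_betw f {..<r} H"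
    using H by (metis ex_bij_betw_nat_finite lessThan_atLeast0)
  have fH: "f i \<in> H" if "i < r" for i
    using bij_betwE[OF f] that by auto
  have corr: "real (card ((\<lambda>n. n + h) ` B \<inter> (\<lambda>n. n + h') ` B)) \<le> e * real M"
    if "h \<in> H" "h' \<in> H" "h < h'" for h h'
  proof -
    have "(\<lambda>n. n + h) ` B \<inter> (\<lambda>n. n + h') ` B = (\<lambda>n. n + h') ` {n \<in> B. n + (h' - h) \<in> B}"
    proof (intro equalityI subsetI)
      fix v assume "v \<in> (\<lambda>n. n + h) ` B \<inter> (\<lambda>n. n + h') ` B"
      then obtain n n' where "n \<in> B" "n' \<in> B" "v = n + h" "v = n' + h'" by auto
      moreover from this have "n = n' + (h' - h)" using that(3) by simp
      ultimately show "v \<in> (\<lambda>n. n + h') ` {n \<in> B. n + (h' - h) \<in> B}" by auto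
    next
      fix v assume "v \<in> (\<lambda>n. n + h') ` {n \<in> B. n + (h' - h) \<in> B}"
      then obtain n where "n \<in> B" "n + (h' - h) \<in> B" "v = n + h'" by auto
      moreover from this have "v = (n + (h' - h)) + h" using that(3) by simp
      ultimately show "v \<in> (\<lambda>n. n + h) ` B \<inter> (\<lambda>n. n + h') ` B" by blast
    qed
    then have "card ((\<lambda>n. n + h) ` B \<inter> (\<lambda>n. n + h') ` B) = card {n \<in> B. n + (h' - h) \<in> B}"
      by (simp add: card_image)
    moreover have "window_corr A k M (h' - h) < e"
      using neg that unfolding e_def by (meson not_le)
    ultimately show ?thesis
      using M by (simp add: window_corr_def B_def field_simps)
  qed
  have "real r * (\<delta> * real M) - real r * real r * (e * real M) \<le> real (card (\<Union>i<r. (\<lambda>n. n + f i) ` B))"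
  proof (rule card_UN_ge_pairwise)
    show "finite ((\<lambda>n. n + f i) ` B)" for i by (simp add: B_def)
    show "\<delta> * real M \<le> real (card ((\<lambda>n. n + f i) ` B))" for i
      using dense by (simp add: card_image B_def)
    show "real (card ((\<lambda>n. n + f i) ` B \<inter> (\<lambda>n. n + f j) ` B)) \<le> e * real M" if "i < j" "j < r" for i j
    proof -
      have "f i \<noteq> f j"
        using f that by (auto simp: bij_betw_def inj_on_def)
      then show ?thesis
        using corr[of "f i" "f j"] corr[of "f j" "f i"] fH that by (metis Int_commute less_trans linorder_neqE_nat)
    qed
  qed (use e in auto)
  also have "real r * real r * (e * real M) = real M / 2"
    using r by (simp add: e_def)
  also have "(\<Union>i<r. (\<lambda>n. n + f i) ` B) \<subseteq> {k+1..k+2*M}"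
    using H(3) fH by (fastforce simp: B_def)
  then have "card (\<Union>i<r. (\<lambda>n. n + f i) ` B) \<le> card {k+1..k+2*M}"
    by (intro card_mono) auto
  then have "real (card (\<Union>i<r. (\<lambda>n. n + f i) ` B)) \<le> 2 * real M"
    by simp
  finally have "real r * \<delta> * real M \<le> 2.5 * real M"
    by (simp add: field_simps)
  moreover have "3 * real M \<le> real r * \<delta> * real M"
    using r by (intro mult_right_mono) auto
  ultimately show False
    using M by simp
qed

lemma window_corr_bounds: "0 \<le> window_corr A k M h" "window_corr A k M h \<le> 1"
proof -
  have "card {n \<in> A \<inter> {k+1..k+M}. n + h \<in> A \<inter> {k+1..k+M}} \<le> card {k+1..k+M}"
    by (intro card_mono) auto
  then show "window_corr A k M h \<le> 1"
    by (auto simp: window_corr_def divide_le_eq_1)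
qed (simp add: window_corr_def)

text \<open>
  Summing the hypothesis over all \<open>n\<close> in the window and exchanging the two sums turns a bound over
  the differences \<open>m - n\<close> into a bound weighted by how often each difference occurs.
\<close>

lemma sum_window_corr_le:
  fixes \<alpha> :: "nat \<Rightarrow> real"
  assumes nonneg: "\<And>h. 0 \<le> \<alpha> h"
    and bound: "\<And>n G. n \<in> A \<Longrightarrow> finite G \<Longrightarrow> G \<subseteq> {m \<in> A. n < m} \<Longrightarrow> (\<Sum>m\<in>G. \<alpha> (m - n)) \<le> D"
    and D: "0 \<le> D" and M: "0 < M"
  shows "(\<Sum>h=1..K. \<alpha> h * window_corr A k M h) \<le> D"
proof -
  define B where "B = A \<inter> {k+1..k+M}"
  have B: "finite B" "B \<subseteq> A" "card B \<le> M"
    using card_mono[of "{k+1..k+M}" B] by (auto simp: B_def)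
  have "(\<Sum>h=1..K. \<alpha> h * real (card {n \<in> B. n + h \<in> B})) = (\<Sum>h=1..K. \<Sum>n\<in>B. if n + h \<in> B then \<alpha> h else 0)"
    using B(1) by (intro sum.cong) (simp_all add: sum.If_cases Int_def)
  also have "\<dots> = (\<Sum>n\<in>B. \<Sum>h=1..K. if n + h \<in> B then \<alpha> h else 0)"
    by (rule sum.swap)
  also have "\<dots> \<le> (\<Sum>n\<in>B. D)"
  proof (rule sum_mono)
    fix n assume n: "n \<in> B"
    have "(\<Sum>h=1..K. if n + h \<in> B then \<alpha> h else 0) = (\<Sum>h\<in>{h\<in>{1..K}. n + h \<in> B}. \<alpha> h)"
      by (simp add: sum.If_cases Int_def)
    also have "\<dots> = (\<Sum>m\<in>(\<lambda>h. n + h) ` {h\<in>{1..K}. n + h \<in> B}. \<alpha> (m - n))"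
      by (subst sum.reindex) auto
    also have "\<dots> \<le> D"
      using n B by (intro bound) auto
    finally show "(\<Sum>h=1..K. if n + h \<in> B then \<alpha> h else 0) \<le> D" .
  qed
  also have "\<dots> \<le> real M * D"
    using B(3) D by (simp add: mult_right_mono)
  finally have "(\<Sum>h=1..K. \<alpha> h * real (card {n \<in> B. n + h \<in> B})) / real M \<le> D"
    using M by (simp add: field_simps)
  then show ?thesis
    by (simp add: window_corr_def B_def sum_divide_distrib)
qed

text \<open>
  Passing to a limit \<open>d h\<close> of the correlations along a sequence of windows gives a weighted bound
  \<open>\<Sum> \<alpha> h * d h \<le> D\<close>. The set \<open>R\<close> of those \<open>h\<close> with \<open>d h\<close> bounded below contains a difference of any
  sufficiently large finite set. A set \<open>F\<close> of maximal size without differences in \<open>R\<close> is therefore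
  available, and by maximality \<open>h + f \<in> R\<close> for some \<open>f \<in> F\<close>, whatever \<open>h \<ge> 1\<close>. Since \<open>\<alpha>\<close> decreases at
  most geometrically, \<open>\<alpha> h\<close> is controlled by \<open>\<alpha> (h + f)\<close>. The growth hypothesis forces the
  translation to go upwards, which is why \<open>0\<close> is added in front of the translate of \<open>F\<close> by \<open>h\<close>.
\<close>

lemma summable_of_difference_sums:
  fixes \<alpha> :: "nat \<Rightarrow> real"
  assumes A: "window_dense Os A" and nonneg: "\<And>h. 0 \<le> \<alpha> h"
    and growth: "\<And>h. \<alpha> h \<le> C * \<alpha> (Suc h)" and C: "1 \<le> C" and D: "0 \<le> D"
    and bound: "\<And>n G. n \<in> A \<Longrightarrow> finite G \<Longrightarrow> G \<subseteq> {m \<in> A. n < m} \<Longrightarrow> (\<Sum>m\<in>G. \<alpha> (m - n)) \<le> D"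
  shows "summable \<alpha>"
proof -
  obtain \<delta> where \<delta>: "\<delta> > 0" "\<And>K. \<exists>M\<ge>K. \<exists>k\<in>Os. \<delta> * real M \<le> real (card (A \<inter> {k+1..k+M}))"
    using A by (auto simp: window_dense_def)
  obtain M k where Mk: "\<And>i. M i \<ge> Suc i" "\<And>i. \<delta> * real (M i) \<le> real (card (A \<inter> {k i+1..k i+M i}))"
    using \<delta>(2)[of "Suc _"] by metis
  have Mpos: "0 < M i" for i
    using Mk(1)[of i] by simp
  have cnt: "countable (UNIV :: nat set)" by simp
  \<comment> \<open>A diagonal argument: correlations lie between \<open>0\<close> and \<open>1\<close>, so along a subsequence of windows all of them converge.\<close>
  obtain \<sigma> :: "nat \<Rightarrow> nat" where \<sigma>: "strict_mono \<sigma>"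
    "\<And>h. \<exists>l. (\<lambda>i. window_corr A (k (\<sigma> i)) (M (\<sigma> i)) h) \<longlonglongrightarrow> l"
    using function_convergent_subsequence[OF cnt, of "\<lambda>i. window_corr A (k i) (M i)" 1] window_corr_bounds
    by (auto simp: real_norm_def)
  then obtain d where d: "\<And>h. (\<lambda>i. window_corr A (k (\<sigma> i)) (M (\<sigma> i)) h) \<longlonglongrightarrow> d h"
    by metis
  have \<sigma>_ge: "i \<le> \<sigma> i" for i
    using \<sigma>(1) by (rule strict_mono_imp_increasing)
  have dsum: "(\<Sum>h=1..K. \<alpha> h * d h) \<le> D" for K
  proof (rule tendsto_upperbound)
    show "(\<lambda>i. \<Sum>h=1..K. \<alpha> h * window_corr A (k (\<sigma> i)) (M (\<sigma> i)) h) \<longlonglongrightarrow> (\<Sum>h=1..K. \<alpha> h * d h)"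
      by (intro tendsto_intros d)
    show "\<forall>\<^sub>F i in sequentially. (\<Sum>h=1..K. \<alpha> h * window_corr A (k (\<sigma> i)) (M (\<sigma> i)) h) \<le> D"
      by (intro always_eventually allI sum_window_corr_le nonneg bound D Mpos)
  qed simp
  have d0: "0 \<le> d h" for h
    by (rule tendsto_lowerbound[OF d]) (auto simp: window_corr_bounds)
  \<comment> \<open>So many translates of density \<open>\<delta>\<close> fill a window three times, yet have only twice its length available.\<close>
  define r where "r = nat \<lceil>3 / \<delta>\<rceil>"
  have r: "3 \<le> real r * \<delta>" "0 < r"
  proof -
    have "3 / \<delta> \<le> real r"
      unfolding r_def by linarith
    then show "3 \<le> real r * \<delta>"
      using \<delta>(1) by (simp add: field_simps)
    then show "0 < r" by (cases r) auto
  qed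
  define e where "e = 1 / (2 * real r * real r)"
  have e: "e > 0" using r by (simp add: e_def)
  define R where "R = {h. e \<le> d h}"
  have meets: "\<exists>h\<in>H. \<exists>h'\<in>H. h < h' \<and> h' - h \<in> R" if H: "finite H" "card H = r" for H
  proof (rule ccontr)
    assume neg: "\<not> ?thesis"
    have "\<forall>\<^sub>F i in sequentially. window_corr A (k (\<sigma> i)) (M (\<sigma> i)) (h' - h) < e"
      if "h \<in> H" "h' \<in> H" "h < h'" for h h'
      using neg that by (intro order_tendstoD(2)[OF d]) (simp add: R_def, meson not_le)
    then have "\<forall>\<^sub>F i in sequentially. \<forall>h\<in>H. \<forall>h'\<in>H. h < h' \<longrightarrow> window_corr A (k (\<sigma> i)) (M (\<sigma> i)) (h' - h) < e"
      using H(1) by (intro eventually_ball_finite ballI) auto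
    moreover have "\<forall>\<^sub>F i in sequentially. i \<ge> Max (insert 0 H)"
      by (rule eventually_ge_at_top)
    ultimately have "\<forall>\<^sub>F i in sequentially. False"
    proof eventually_elim
      case (elim i)
      have "h \<le> M (\<sigma> i)" if "h \<in> H" for h
      proof -
        have "h \<le> i" using elim(2) H(1) that by simp
        also have "\<dots> \<le> \<sigma> i" by (rule \<sigma>_ge)
        finally show ?thesis using Mk(1)[of "\<sigma> i"] by simp
      qed
      from window_corr_large[OF r Mk(2)[of "\<sigma> i"] H this Mpos] elim(1) show False
        unfolding e_def by fastforce
    qed
    then show False by simp
  qed
  define free where "free = (\<lambda>F. finite F \<and> (\<forall>h\<in>F. \<forall>h'\<in>F. h < h' \<longrightarrow> h' - h \<notin> R))"
  have small: "card F < r" if "free F" for F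
  proof (rule ccontr)
    assume "\<not> card F < r"
    then obtain H where "H \<subseteq> F" "card H = r"
      by (meson not_le obtain_subset_with_card_n)
    with that meets[of H] show False
      unfolding free_def by (meson finite_subset subsetD)
  qed
  have "free {}" by (simp add: free_def)
  then have "\<exists>F. free F \<and> (\<forall>F'. free F' \<longrightarrow> card F' \<le> card F)"
    using small by (intro ex_has_greatest_nat[of _ _ _ r]) auto
  then obtain F where F: "free F" "\<And>F'. free F' \<Longrightarrow> card F' \<le> card F"
    by blast
  have finF: "finite F" using F by (simp add: free_def)
  have cover: "\<exists>f\<in>F. f + h \<in> R" if h: "1 \<le> h" for h
  proof (rule ccontr)
    assume neg: "\<not> ?thesis"
    let ?F' = "insert 0 ((\<lambda>f. f + h) ` F)"
    have "free ?F'"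
      using F(1) neg by (auto simp: free_def)
    moreover have "card ?F' = Suc (card F)"
      using h finF by (subst card_insert_disjoint) (auto simp: card_image)
    ultimately show False
      using F(2) by fastforce
  qed
  have grow: "\<alpha> h \<le> C ^ f * \<alpha> (f + h)" for f h
  proof (induction f)
    case (Suc f)
    have "C ^ f * \<alpha> (f + h) \<le> C ^ f * (C * \<alpha> (Suc (f + h)))"
      using C by (intro mult_left_mono growth) auto
    with Suc show ?case by (simp add: mult_ac)
  qed simp
  have each: "\<alpha> h \<le> (\<Sum>f\<in>F. C ^ f * (\<alpha> (f + h) * d (f + h) / e))" if h: "1 \<le> h" for h
  proof -
    obtain f where f: "f \<in> F" "f + h \<in> R" using cover[OF h] by blast
    have "1 \<le> d (f + h) / e"
      using f(2) e by (simp add: R_def)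
    then have "\<alpha> (f + h) * 1 \<le> \<alpha> (f + h) * (d (f + h) / e)"
      by (intro mult_left_mono nonneg)
    then have "C ^ f * \<alpha> (f + h) \<le> C ^ f * (\<alpha> (f + h) * d (f + h) / e)"
      using C by (intro mult_left_mono) auto
    also have "\<dots> \<le> (\<Sum>f\<in>F. C ^ f * (\<alpha> (f + h) * d (f + h) / e))"
      using f(1) finF C e by (intro member_le_sum) (auto intro!: mult_nonneg_nonneg divide_nonneg_pos nonneg d0)
    finally show ?thesis
      using grow[of h f] by simp
  qed
  have "(\<Sum>h=1..K. \<alpha> h) \<le> (\<Sum>f\<in>F. C ^ f * (D / e))" for K
  proof -
    have "(\<Sum>h=1..K. \<alpha> h) \<le> (\<Sum>h=1..K. \<Sum>f\<in>F. C ^ f * (\<alpha> (f + h) * d (f + h) / e))"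
      by (intro sum_mono each) auto
    also have "\<dots> = (\<Sum>f\<in>F. C ^ f * ((\<Sum>h=1..K. \<alpha> (f + h) * d (f + h)) / e))"
      by (subst sum.swap) (simp add: sum_distrib_left sum_divide_distrib)
    also have "\<dots> \<le> (\<Sum>f\<in>F. C ^ f * (D / e))"
    proof (intro sum_mono mult_left_mono divide_right_mono)
      fix f
      have "(\<Sum>h=1..K. \<alpha> (f + h) * d (f + h)) = (\<Sum>h\<in>(\<lambda>h. f + h) ` {1..K}. \<alpha> h * d h)"
        by (subst sum.reindex) auto
      also have "\<dots> \<le> (\<Sum>h=1..f+K. \<alpha> h * d h)"
        by (intro sum_mono2) (auto intro: mult_nonneg_nonneg nonneg d0)
      also have "\<dots> \<le> D" by (rule dsum)
      finally show "(\<Sum>h=1..K. \<alpha> (f + h) * d (f + h)) \<le> D" .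
    qed (use C e in auto)
    finally show ?thesis .
  qed
  then have "(\<Sum>h<K. \<alpha> (Suc h)) \<le> (\<Sum>f\<in>F. C ^ f * (D / e))" for K
    by (simp add: sum.atLeast1_atMost_eq)
  then have "summable (\<lambda>h. \<alpha> (Suc h))"
    using nonneg by (intro summableI_nonneg_bounded)
  then show ?thesis
    by (simp add: summable_Suc_iff)
qed

section \<open>Finite sums, extended sums and entries of vectors\<close>

lemma sum_le_lp_norm:
  assumes p: "1 \<le> p" and x: "x \<in> lp p" and F: "finite F" "F \<subseteq> {1..}"
  shows "(\<Sum>n\<in>F. norm (x n) powr p) \<le> lp_norm p x powr p"
proof -
  have s: "(\<lambda>n. norm (x n) powr p) summable_on {1..}"
    using x by (simp add: lp_def)
  have "0 \<le> (\<Sum>\<^sub>\<infinity>n\<in>{1..}. norm (x n) powr p)"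
    by (rule infsum_nonneg) simp
  then have "lp_norm p x powr p = (\<Sum>\<^sub>\<infinity>n\<in>{1..}. norm (x n) powr p)"
    using p by (simp add: lp_norm_def powr_powr)
  then show ?thesis
    using finite_sum_le_infsum[OF s F] by simp
qed

lemma norm_coord_le_lp_norm:
  assumes "1 \<le> p" "x \<in> lp p" "1 \<le> n"
  shows "norm (x n) \<le> lp_norm p x"
proof -
  have "norm (x n) powr p \<le> lp_norm p x powr p"
    using sum_le_lp_norm[of p x "{n}"] assms by simp
  moreover have "0 \<le> lp_norm p x"
    by (simp add: lp_norm_def)
  ultimately show ?thesis
    using assms(1) by (metis norm_ge_zero not_le powr_less_mono2 less_le_trans zero_less_one)
qed

text \<open>
  Together with \<open>sum_le_lp_norm\<close> this reduces all estimates in \<open>\<ell>\<^sup>p\<close> to finite sums of real numbers,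
  where reindexing and exchanging sums need no summability.
\<close>

lemma lp_bounded_sumsI:
  fixes x :: "nat \<Rightarrow> 'a::real_normed_field"
  assumes p: "1 \<le> p" and x0: "x 0 = 0"
    and bound: "\<And>F. finite F \<Longrightarrow> F \<subseteq> {1..} \<Longrightarrow> (\<Sum>n\<in>F. norm (x n) powr p) \<le> B"
  shows "x \<in> lp p" and "lp_norm p x \<le> B powr (1 / p)"
proof -
  have s: "(\<lambda>n. norm (x n) powr p) summable_on {1..}"
    using bound by (intro nonneg_bdd_above_summable_on) (auto intro!: bdd_aboveI[of _ B])
  then show "x \<in> lp p"
    using x0 by (simp add: lp_def)
  have "(\<Sum>\<^sub>\<infinity>n\<in>{1..}. norm (x n) powr p) \<le> B"
    by (rule infsum_le_finite_sums[OF s bound])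
  then show "lp_norm p x \<le> B powr (1 / p)"
    unfolding lp_norm_def using p by (intro powr_mono2 infsum_nonneg) auto
qed

lemma finite_support_in_lp:
  assumes "y 0 = 0" "\<And>q. l < q \<Longrightarrow> y q = 0"
  shows "y \<in> lp p"
proof -
  have "(\<lambda>n. norm (y n) powr p) summable_on {1..l}"
    by simp
  then have "(\<lambda>n. norm (y n) powr p) summable_on {1..}"
    by (rule summable_on_cong_neutral[THEN iffD1, rotated -1]) (use assms in auto)
  then show ?thesis
    using assms by (simp add: lp_def)
qed

lemma canonical_basis_in_lp: "1 \<le> j \<Longrightarrow> canonical_basis j \<in> lp p"
  by (rule finite_support_in_lp[of _ j]) (auto simp: canonical_basis_def)

lemma summable_small_finite_tails:
  fixes f :: "nat \<Rightarrow> real"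
  assumes f: "summable f" and nn: "\<And>n. 0 \<le> f n" and e: "0 < e"
  obtains M where "\<And>G. finite G \<Longrightarrow> G \<subseteq> {M..} \<Longrightarrow> sum f G \<le> e"
proof -
  obtain M where M: "norm (\<Sum>i. f (i + M)) < e"
    using suminf_exist_split[OF e f] by blast
  have "sum f G \<le> e" if G: "finite G" "G \<subseteq> {M..}" for G
  proof -
    have "sum f G = (\<Sum>i\<in>(\<lambda>n. n - M) ` G. f (i + M))"
      using G(2) by (subst sum.reindex) (auto intro!: inj_onI sum.cong simp: eq_diff_iff subset_eq)
    also have "\<dots> \<le> (\<Sum>i. f (i + M))"
      using nn G(1) by (intro sum_le_suminf summable_ignore_initial_segment f) auto
    also have "\<dots> \<le> e" using M by simp
    finally show ?thesis .
  qed
  then show thesis by (rule that)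
qed

lemma finite_sums_le_imp_infsum_ennreal_le:
  fixes f g :: "nat \<Rightarrow> real"
  assumes "\<And>m. m \<in> S \<Longrightarrow> 0 \<le> f m" "\<And>m. m \<in> S \<Longrightarrow> 0 < g m" "0 \<le> B"
    and "\<And>G. finite G \<Longrightarrow> G \<subseteq> S \<Longrightarrow> (\<Sum>m\<in>G. f m / g m) \<le> B"
  shows "(\<Sum>\<^sub>\<infinity>m\<in>S. ennreal (f m) / ennreal (g m)) \<le> ennreal B"
proof (rule infsum_le_finite_sums)
  fix G assume G: "finite G" "G \<subseteq> S"
  have "(\<Sum>m\<in>G. ennreal (f m) / ennreal (g m)) = (\<Sum>m\<in>G. ennreal (f m / g m))"
    using assms G by (intro sum.cong) (auto intro!: divide_ennreal)
  also have "\<dots> = ennreal (\<Sum>m\<in>G. f m / g m)"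
    using assms(1,2) G by (intro sum_ennreal) (auto intro!: divide_nonneg_pos)
  also have "\<dots> \<le> ennreal B"
    using assms G by (intro ennreal_leI)
  finally show "(\<Sum>m\<in>G. ennreal (f m) / ennreal (g m)) \<le> ennreal B" .
qed (rule nonneg_summable_on_complete, simp)

lemma infsum_ennreal_le_imp_finite_sums_le:
  fixes f g :: "nat \<Rightarrow> real"
  assumes "\<And>m. m \<in> S \<Longrightarrow> 0 \<le> f m" "\<And>m. m \<in> S \<Longrightarrow> 0 < g m" "0 \<le> B"
    and le: "(\<Sum>\<^sub>\<infinity>m\<in>S. ennreal (f m) / ennreal (g m)) \<le> ennreal B" and G: "finite G" "G \<subseteq> S"
  shows "(\<Sum>m\<in>G. f m / g m) \<le> B"
proof -
  have "ennreal (\<Sum>m\<in>G. f m / g m) = (\<Sum>m\<in>G. ennreal (f m / g m))"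
    using assms(1,2) G by (intro sum_ennreal[symmetric]) (auto intro!: divide_nonneg_pos)
  also have "\<dots> = (\<Sum>m\<in>G. ennreal (f m) / ennreal (g m))"
    using assms G by (intro sum.cong) (auto intro!: divide_ennreal[symmetric])
  also have "\<dots> \<le> (SUP F\<in>{F. finite F \<and> F \<subseteq> S}. \<Sum>m\<in>F. ennreal (f m) / ennreal (g m))"
    using G by (intro SUP_upper) auto
  also have "\<dots> = (\<Sum>\<^sub>\<infinity>m\<in>S. ennreal (f m) / ennreal (g m))"
    by (rule nonneg_infsum_complete[symmetric]) simp
  finally show ?thesis
    using le \<open>0 \<le> B\<close> by (meson ennreal_le_iff order_trans)
qed

section \<open>Products of weights and iterates of weighted shifts\<close>

lemma weight_prod_add: "weight_prod w l (m + n) = weight_prod w l m * weight_prod w (l + m) n"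
proof -
  have "(\<Prod>\<nu>=1..m+n. w (l + \<nu>)) = (\<Prod>\<nu>=1..m. w (l + \<nu>)) * (\<Prod>\<nu>=m+1..m+n. w (l + \<nu>))"
    by (metis Suc_eq_plus1 le_add2 plus_1_eq_Suc prod.ub_add_nat)
  also have "(\<Prod>\<nu>=m+1..m+n. w (l + \<nu>)) = (\<Prod>\<nu>=1..n. w (l + m + \<nu>))"
    using prod.shift_bounds_cl_nat_ivl[of "\<lambda>\<nu>. w (l + \<nu>)" 1 m n] by (simp add: ac_simps)
  finally show ?thesis
    by (simp add: weight_prod_def)
qed

lemma weight_prod_Suc: "weight_prod w l (Suc n) = weight_prod w l n * w (l + Suc n)"
  by (simp add: weight_prod_def)

lemma norm_weight_prod_le:
  fixes w :: "nat \<Rightarrow> 'a::real_normed_field"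
  assumes "\<And>n. 1 \<le> n \<Longrightarrow> norm (w n) \<le> C"
  shows "norm (weight_prod w q n) \<le> C ^ n"
proof (induction n)
  case (Suc n)
  have "0 \<le> C" using assms[of 1] norm_ge_zero order_trans by blast
  then have "norm (weight_prod w q n) * norm (w (q + Suc n)) \<le> C ^ n * C"
    by (intro mult_mono Suc assms) auto
  then show ?case
    by (simp add: weight_prod_Suc norm_mult mult.commute)
qed (simp add: weight_prod_def)

lemma weighted_shift_power:
  "1 \<le> q \<Longrightarrow> (weighted_shift w ^^ n) x q = weight_prod w q n * x (q + n)"
proof (induction n arbitrary: q)
  case (Suc n)
  have "(weighted_shift w ^^ Suc n) x q = w (q + 1) * (weighted_shift w ^^ n) x (q + 1)"
    using Suc.prems by (simp add: weighted_shift_def)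
  also have "\<dots> = weight_prod w q 1 * weight_prod w (q + 1) n * x (q + Suc n)"
    using Suc.IH[of "q + 1"] by (simp add: weight_prod_def)
  also have "weight_prod w q 1 * weight_prod w (q + 1) n = weight_prod w q (Suc n)"
    using weight_prod_add[of w q 1 n] by simp
  finally show ?case .
qed (simp add: weight_prod_def)

lemma weighted_shift_power_in_lp:
  fixes w x :: "nat \<Rightarrow> 'a::real_normed_field"
  assumes "1 \<le> p" "bounded (w ` {1..})" "x \<in> lp p"
  shows "(weighted_shift w ^^ n) x \<in> lp p"
  by (induction n) (use assms in \<open>auto intro: weighted_shift_in_lp\<close>)

text \<open>
  Division by zero yields \<open>\<infinity>\<close> in the extended nonnegative reals, which is what encodes that all
  products of weights are nonzero; at the index \<open>0\<close> the product is empty, hence nonzero as well.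
\<close>

lemma infsum_inverse_weights_finite_iff:
  fixes w :: "nat \<Rightarrow> 'a::real_normed_field"
  shows "(\<Sum>\<^sub>\<infinity>n\<in>{1..}. 1 / ennreal (norm (weight_prod w j n) powr p)) < \<infinity> \<longleftrightarrow>
    (\<forall>n. weight_prod w j n \<noteq> 0) \<and> summable (\<lambda>n. 1 / norm (weight_prod w j n) powr p)"
    (is "?I < \<infinity> \<longleftrightarrow> _")
proof (intro iffI conjI)
  assume fin: "?I < \<infinity>"
  show nz: "\<forall>n. weight_prod w j n \<noteq> 0"
  proof (intro allI notI)
    fix n assume 0: "weight_prod w j n = 0"
    then have n: "n \<in> {1..}"
      by (cases n) (auto simp: weight_prod_def)
    have "(\<Sum>m\<in>{n}. 1 / ennreal (norm (weight_prod w j m) powr p)) \<le>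
        (SUP F\<in>{F. finite F \<and> F \<subseteq> {1..}}. \<Sum>m\<in>F. 1 / ennreal (norm (weight_prod w j m) powr p))"
      using n by (intro SUP_upper) auto
    also have "\<dots> = ?I"
      by (rule nonneg_infsum_complete[symmetric]) simp
    finally show False
      using fin 0 by (simp add: ennreal_divide_eq_top_iff top_unique)
  qed
  obtain B where B: "0 \<le> B" "?I = ennreal B"
    using fin by (cases ?I) auto
  have "(\<Sum>n\<in>G. 1 / norm (weight_prod w j n) powr p) \<le> B" if "finite G" "G \<subseteq> {1..}" for G
    using infsum_ennreal_le_imp_finite_sums_le[of "{1..}" "\<lambda>_. 1" "\<lambda>n. norm (weight_prod w j n) powr p" B G] nz B that
    by simp
  from this[of "Suc ` {..<_}"] have "(\<Sum>n<K. 1 / norm (weight_prod w j (Suc n)) powr p) \<le> B" for K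
    by (simp add: sum.reindex image_subset_iff)
  then have "summable (\<lambda>n. 1 / norm (weight_prod w j (Suc n)) powr p)"
    by (intro summableI_nonneg_bounded) auto
  then show "summable (\<lambda>n. 1 / norm (weight_prod w j n) powr p)"
    by (subst (asm) summable_Suc_iff)
next
  assume *: "(\<forall>n. weight_prod w j n \<noteq> 0) \<and> summable (\<lambda>n. 1 / norm (weight_prod w j n) powr p)"
  have "(\<Sum>\<^sub>\<infinity>n\<in>{1..}. ennreal 1 / ennreal (norm (weight_prod w j n) powr p)) \<le>
      ennreal (\<Sum>n. 1 / norm (weight_prod w j n) powr p)"
    using * by (intro finite_sums_le_imp_infsum_ennreal_le sum_le_suminf suminf_nonneg) auto
  then show "?I < \<infinity>"
    by (simp add: order_le_less_trans)
qed

section \<open>Disjoint hypercyclicity in terms of the norm\<close>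

lemma disjoint_hypercyclicD:
  fixes T :: "nat \<Rightarrow> (nat \<Rightarrow> 'a::real_normed_field) \<Rightarrow> nat \<Rightarrow> 'a"
  assumes p: "1 \<le> p" and dh: "disjoint_hypercyclic \<A> (lp_topology p) N T"
  obtains x where "x \<in> lp p"
    "\<And>y r. (\<And>s. s \<in> {1..N} \<Longrightarrow> y s \<in> lp p) \<Longrightarrow> 0 < r \<Longrightarrow>
      {n. 1 \<le> n \<and> (\<forall>s\<in>{1..N}. (T s ^^ n) x \<in> lp p \<and> lp_dist p (y s) ((T s ^^ n) x) < r)} \<in> \<A>"
proof -
  interpret Metric_space "lp p :: (nat \<Rightarrow> 'a) set" "lp_dist p"
    by (rule Metric_space_lp[OF p])
  obtain x where x: "x \<in> lp p" "\<And>V. (\<forall>s\<in>{1..N}. openin mtopology (V s) \<and> V s \<noteq> {}) \<Longrightarrow>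
        {n. 1 \<le> n \<and> (\<forall>s\<in>{1..N}. (T s ^^ n) x \<in> V s)} \<in> \<A>"
    using dh by (auto simp: disjoint_hypercyclic_def lp_topology_def)
  show thesis
  proof (rule that[OF x(1)])
    fix y :: "nat \<Rightarrow> nat \<Rightarrow> 'a" and r assume y: "\<And>s. s \<in> {1..N} \<Longrightarrow> y s \<in> lp p" and r: "0 < (r::real)"
    have "y s \<in> mball (y s) r" if "s \<in> {1..N}" for s
      using y[OF that] r by simp
    then have "{n. 1 \<le> n \<and> (\<forall>s\<in>{1..N}. (T s ^^ n) x \<in> mball (y s) r)} \<in> \<A>"
      by (intro x(2) ballI conjI openin_mball) blast
    also have "{n. 1 \<le> n \<and> (\<forall>s\<in>{1..N}. (T s ^^ n) x \<in> mball (y s) r)} =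
      {n. 1 \<le> n \<and> (\<forall>s\<in>{1..N}. (T s ^^ n) x \<in> lp p \<and> lp_dist p (y s) ((T s ^^ n) x) < r)}"
      using y by (auto simp: in_mball)
    finally show "\<dots> \<in> \<A>" .
  qed
qed

text \<open>
  Balls with a common radius suffice, because only finitely many open sets are prescribed at a time.
\<close>

lemma disjoint_hypercyclicI:
  fixes T :: "nat \<Rightarrow> (nat \<Rightarrow> 'a::real_normed_field) \<Rightarrow> nat \<Rightarrow> 'a"
  assumes p: "1 \<le> p" and x: "x \<in> lp p" 
    and up: "\<And>A B. A \<in> \<A> \<Longrightarrow> A \<subseteq> B \<Longrightarrow> B \<subseteq> {1..} \<Longrightarrow> B \<in> \<A>"
    and ret: "\<And>y r. (\<And>s. s \<in> {1..N} \<Longrightarrow> y s \<in> lp p) \<Longrightarrow> 0 < r \<Longrightarrow>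
      \<exists>A\<in>\<A>. A \<subseteq> {1..} \<and> (\<forall>n\<in>A. \<forall>s\<in>{1..N}. (T s ^^ n) x \<in> lp p \<and> lp_dist p (y s) ((T s ^^ n) x) < r)"
  shows "disjoint_hypercyclic \<A> (lp_topology p) N T"
proof -
  interpret Metric_space "lp p :: (nat \<Rightarrow> 'a) set" "lp_dist p"
    by (rule Metric_space_lp[OF p])
  have "{n. 1 \<le> n \<and> (\<forall>s\<in>{1..N}. (T s ^^ n) x \<in> V s)} \<in> \<A>"
    if V: "\<forall>s\<in>{1..N}. openin mtopology (V s) \<and> V s \<noteq> {}" for V
  proof -
    have "\<exists>y r. y \<in> lp p \<and> 0 < r \<and> mball y r \<subseteq> V s" if "s \<in> {1..N}" for s
      using V that by (metis equals0I openin_mtopology subsetD)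
    then obtain y r where yr: "\<And>s. s \<in> {1..N} \<Longrightarrow> y s \<in> lp p \<and> 0 < r s \<and> mball (y s) (r s) \<subseteq> V s"
      by metis
    define r' where "r' = Min (insert 1 (r ` {1..N}))"
    have "0 < r'"
      using yr by (auto simp: r'_def)
    moreover have "r' \<le> r s" if "s \<in> {1..N}" for s
      unfolding r'_def using that by (intro Min_le) auto
    ultimately have r': "0 < r'" "\<And>s. s \<in> {1..N} \<Longrightarrow> r' \<le> r s"
      by auto
    obtain A where A: "A \<in> \<A>" "A \<subseteq> {1..}" "\<forall>n\<in>A. \<forall>s\<in>{1..N}. (T s ^^ n) x \<in> lp p \<and> lp_dist p (y s) ((T s ^^ n) x) < r'"
      using ret[of y r'] yr r' by blast
    have "(T s ^^ n) x \<in> V s" if "n \<in> A" "s \<in> {1..N}" for n s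
    proof -
      have "(T s ^^ n) x \<in> mball (y s) (r s)"
        using A(3) that yr[OF that(2)] r'(2)[OF that(2)] by (force simp: in_mball)
      then show ?thesis using yr[OF that(2)] by blast
    qed
    then show ?thesis
      using A(2) by (intro up[OF A(1)]) auto
  qed
  then show ?thesis
    using x by (auto simp: disjoint_hypercyclic_def lp_topology_def)
qed

section \<open>What return times force on the weights\<close>

text \<open>
  For \<open>n < m\<close> in \<open>A\<close>, the factorization \<open>W\<^sub>j\<^sub>,\<^sub>m = W\<^sub>j\<^sub>,\<^sub>m\<^sub>-\<^sub>n W\<^sub>j\<^sub>+\<^sub>m\<^sub>-\<^sub>n\<^sub>,\<^sub>n\<close> says that the entry of \<open>T\<^sup>n x\<close> at
  \<open>j + m - n\<close> is \<open>(T\<^sup>m x)\<^sub>j / W\<^sub>j\<^sub>,\<^sub>m\<^sub>-\<^sub>n\<close>, whose numerator is at least \<open>1 / 2\<close>. As \<open>T\<^sup>n x\<close> is close to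
  \<open>e\<^sub>j\<close>, the inverse products at the differences \<open>m - n\<close> are summable with a bound independent of \<open>n\<close>.
\<close>

lemma returns_imp_summable_inverse_weights:
  fixes w x :: "nat \<Rightarrow> 'a::real_normed_field"
  assumes p: "1 \<le> p" and w: "bounded (w ` {1..})" and x: "x \<in> lp p" and j: "1 \<le> j"
    and A: "window_dense Os A"
    and ret: "\<And>n. n \<in> A \<Longrightarrow> lp_dist p (canonical_basis j) ((weighted_shift w ^^ n) x) < 1 / 2"
  shows "weight_prod w j n \<noteq> 0" and "summable (\<lambda>n. 1 / norm (weight_prod w j n) powr p)"
proof -
  define z where "z = (\<lambda>n q. canonical_basis j q - (weighted_shift w ^^ n) x q)"
  have z_lp: "z n \<in> lp p" for n
    unfolding z_def
    by (intro lp_diff_closed[OF p] canonical_basis_in_lp j weighted_shift_power_in_lp w x p)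
  have z_norm: "lp_norm p (z n) < 1 / 2" if "n \<in> A" for n
    using ret[OF that] by (simp add: lp_dist_def z_def)
  have big: "1 / 2 \<le> norm (weight_prod w j n * x (j + n))" if "n \<in> A" for n
  proof -
    have "norm (z n j) < 1 / 2"
      using norm_coord_le_lp_norm[OF p z_lp j] z_norm[OF that] by (rule le_less_trans)
    then have "norm (1 - weight_prod w j n * x (j + n)) < 1 / 2"
      using j by (simp add: z_def weighted_shift_power canonical_basis_def)
    moreover have "norm (1 :: 'a) \<le> norm (1 - weight_prod w j n * x (j + n)) + norm (weight_prod w j n * x (j + n))"
      by (metis diff_add_cancel norm_triangle_ineq)
    ultimately show ?thesis by simp
  qed
  show nz: "weight_prod w j n \<noteq> 0" for n
  proof
    assume 0: "weight_prod w j n = 0"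
    obtain m where m: "m \<in> A" "n \<le> m"
      using window_dense_unbounded[OF A] by blast
    have "weight_prod w j m = 0"
      using weight_prod_add[of w j n "m - n"] m(2) 0 by simp
    then show False using big[OF m(1)] by simp
  qed
  obtain C0 where C0: "\<And>n. 1 \<le> n \<Longrightarrow> norm (w n) \<le> C0"
    using w by (force simp: bounded_iff)
  define C where "C = max 1 C0"
  have C: "1 \<le> C" "\<And>n. 1 \<le> n \<Longrightarrow> norm (w n) \<le> C"
    using C0 by (force simp: C_def)+
  show "summable (\<lambda>n. 1 / norm (weight_prod w j n) powr p)"
  proof (rule summable_of_difference_sums[OF A])
    show "1 / norm (weight_prod w j h) powr p \<le> C powr p * (1 / norm (weight_prod w j (Suc h)) powr p)" for h
    proof -
      have "norm (weight_prod w j (Suc h)) \<le> norm (weight_prod w j h) * C"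
        using C(2)[of "j + Suc h"] by (simp add: weight_prod_Suc norm_mult mult_left_mono)
      then have "norm (weight_prod w j (Suc h)) powr p \<le> norm (weight_prod w j h) powr p * C powr p"
        using p C(1) by (subst powr_mult[symmetric]) (auto intro!: powr_mono2)
      then show ?thesis
        using nz by (simp add: field_simps)
    qed
    show "1 \<le> C powr p"
      using C(1) p by (simp add: ge_one_powr_ge_zero)
    show "(\<Sum>m\<in>G. 1 / norm (weight_prod w j (m - n)) powr p) \<le> 1"
      if n: "n \<in> A" and G: "finite G" "G \<subseteq> {m \<in> A. n < m}" for n G
    proof -
      \<comment> \<open>Since \<open>m > n\<close>, the position \<open>j + (m - n)\<close> is off the support \<open>{j}\<close> of the target.\<close>
      have term_le: "1 / norm (weight_prod w j (m - n)) powr p \<le> 2 powr p * norm (z n (j + (m - n))) powr p"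
        if "m \<in> G" for m
      proof -
        have m: "m \<in> A" "n < m" using G that by auto
        have "z n (j + (m - n)) = - (weight_prod w (j + (m - n)) n * x (j + m))"
          using m j by (simp add: z_def weighted_shift_power canonical_basis_def)
        moreover have "weight_prod w j m = weight_prod w j (m - n) * weight_prod w (j + (m - n)) n"
          using weight_prod_add[of w j "m - n" n] m by simp
        ultimately have "1 / 2 \<le> norm (weight_prod w j (m - n)) * norm (z n (j + (m - n)))"
          using big[OF m(1)] by (simp add: norm_mult mult.assoc)
        then have "1 / norm (weight_prod w j (m - n)) \<le> 2 * norm (z n (j + (m - n)))"
          using nz[of "m - n"] by (simp add: field_simps)
        then have "(1 / norm (weight_prod w j (m - n))) powr p \<le> (2 * norm (z n (j + (m - n)))) powr p"
          using p by (intro powr_mono2) auto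
        then show ?thesis
          by (simp add: powr_divide powr_mult)
      qed
      have "(\<Sum>m\<in>G. 1 / norm (weight_prod w j (m - n)) powr p) \<le>
          2 powr p * (\<Sum>m\<in>G. norm (z n (j + (m - n))) powr p)"
        unfolding sum_distrib_left by (rule sum_mono[OF term_le])
      also have "(\<Sum>m\<in>G. norm (z n (j + (m - n))) powr p) = (\<Sum>q\<in>(\<lambda>m. j + (m - n)) ` G. norm (z n q) powr p)"
        using G(2) by (subst sum.reindex) (auto intro!: inj_onI simp: eq_diff_iff)
      also have "\<dots> \<le> lp_norm p (z n) powr p"
        using G(1) j by (intro sum_le_lp_norm p z_lp) auto
      also have "\<dots> \<le> (1 / 2) powr p"
        using z_norm[OF n] p by (intro powr_mono2) (auto simp: lp_norm_def)
      finally show ?thesis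
        by (simp add: powr_divide)
    qed
  qed auto
qed

text \<open>
  Quantitative continuity of the quotient at \<open>(a, b)\<close>. The radius is written as \<open>\<rho> \<mu> / 2\<close> with
  \<open>\<rho> \<le> 1\<close> so that the denominator keeps half of its size and the error is linear in \<open>\<rho>\<close>.
\<close>

lemma norm_divide_diff_le:
  fixes u v a b :: "'a::real_normed_field"
  assumes "norm (u - a) \<le> r" "norm (v - b) \<le> r" "\<mu> \<le> norm a" "\<mu> \<le> norm b" "norm a \<le> L"
    "2 * r = \<rho> * \<mu>" "\<rho> \<le> 1" "0 < \<mu>"
  shows "\<mu> / 2 \<le> norm v" and "norm (u / v - a / b) \<le> \<rho> * (1 + L / \<mu>)"
proof -
  have r0: "0 \<le> r" using assms(1) norm_ge_zero order_trans by blast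
  have "norm b \<le> norm (b - v) + norm v"
    by (metis diff_add_cancel norm_triangle_ineq)
  moreover have "\<rho> * \<mu> \<le> 1 * \<mu>"
    using assms by (intro mult_right_mono) auto
  moreover have "norm (b - v) \<le> r"
    using assms(2) by (simp add: norm_minus_commute)
  ultimately show v: "\<mu> / 2 \<le> norm v"
    using assms(4,6) by linarith
  then have nz: "v \<noteq> 0" "b \<noteq> 0" using assms by auto
  have "u / v - a / b = (u - a) / v + a / b * ((b - v) / v)"
    using nz by (simp add: field_simps)
  then have "norm (u / v - a / b) \<le> norm (u - a) / norm v + norm a / norm b * (norm (b - v) / norm v)"
    by (metis norm_triangle_ineq norm_mult norm_divide)
  also have "\<dots> \<le> r / (\<mu> / 2) + L / \<mu> * (r / (\<mu> / 2))"
    using assms v r0 by (intro add_mono mult_mono frac_le) (auto simp: norm_minus_commute intro: order_trans[OF norm_ge_zero])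
  also have "\<dots> = \<rho> * (1 + L / \<mu>)"
    using assms(6,8) by (simp add: field_simps)
  finally show "norm (u / v - a / b) \<le> \<rho> * (1 + L / \<mu>)" .
qed

text \<open>
  The return set is thinned so that its gaps are at least \<open>l\<close>: then \<open>j + m - n\<close> exceeds \<open>l\<close>, the
  target vanishes there, and \<open>W\<^sup>s\<^sub>j\<^sub>+\<^sub>m\<^sub>-\<^sub>n\<^sub>,\<^sub>n x\<^sub>j\<^sub>+\<^sub>m\<close> is an entry of the small vector \<open>T\<^sub>s\<^sup>n x - y\<^sub>s\<close>. Dividing by
  \<open>\<bar>W\<^sup>t\<^sub>j\<^sub>,\<^sub>m x\<^sub>j\<^sub>+\<^sub>m\<bar> \<ge> \<mu> / 2\<close> removes the unknown \<open>x\<^sub>j\<^sub>+\<^sub>m\<close>.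
\<close>

lemma returns_imp_comparison:
  fixes w :: "nat \<Rightarrow> nat \<Rightarrow> 'a::real_normed_field"
  assumes p: "1 \<le> p" and w: "\<And>s. s \<in> {1..N} \<Longrightarrow> bounded (w s ` {1..})" and x: "x \<in> lp p"
    and N: "1 \<le> N" and l: "1 \<le> l" and a: "\<And>s j. s \<in> {1..N} \<Longrightarrow> j \<in> {1..l} \<Longrightarrow> a s j \<noteq> 0"
    and \<epsilon>: "0 < \<epsilon>"
    and ret: "\<And>y r. (\<And>s. s \<in> {1..N} \<Longrightarrow> y s \<in> lp p) \<Longrightarrow> 0 < r \<Longrightarrow>
      window_dense Os {n. 1 \<le> n \<and> (\<forall>s\<in>{1..N}. lp_dist p (y s) ((weighted_shift (w s) ^^ n) x) < r)}"
  shows "\<exists>A. window_dense Os A \<and> (\<forall>s\<in>{1..N}. \<forall>t\<in>{1..N}. \<forall>n\<in>A. \<forall>j\<in>{1..l}.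
      (\<Sum>\<^sub>\<infinity>m\<in>{m \<in> A. m > n}.
            ennreal (norm (weight_prod (w s) (j + m - n) n) powr p) /
            ennreal (norm (weight_prod (w t) j m) powr p)) \<le> ennreal \<epsilon> \<and>
      norm (weight_prod (w s) j n / weight_prod (w t) j n - a s j / a t j) \<le> \<epsilon>)"
proof -
  define S where "S = (\<lambda>(s, j). norm (a s j)) ` ({1..N} \<times> {1..l})"
  have S: "finite S" "S \<noteq> {}" "\<And>s j. s \<in> {1..N} \<Longrightarrow> j \<in> {1..l} \<Longrightarrow> norm (a s j) \<in> S"
    using N l by (auto simp: S_def)
  define \<mu> L where "\<mu> = Min S" and "L = Max S"
  have "\<mu> \<in> S" unfolding \<mu>_def using S by (intro Min_in)
  then have \<mu>0: "0 < \<mu>" using a by (auto simp: S_def)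
  have \<mu>L: "\<mu> \<le> norm (a s j)" "norm (a s j) \<le> L" if "s \<in> {1..N}" "j \<in> {1..l}" for s j
    using S that by (auto simp: \<mu>_def L_def)
  have L0: "0 < L" using \<mu>L[of 1 1] N l \<mu>0 by auto
  \<comment> \<open>Relative accuracy: \<open>\<rho> \<le> 1\<close> gives \<open>\<rho>\<^sup>p \<le> \<rho>\<close>, and \<open>\<rho> * (1 + L / \<mu>)\<close> is the error of a quotient.\<close>
  define \<rho> where "\<rho> = min 1 (\<epsilon> / (1 + L / \<mu>))"
  have LM: "0 < L / \<mu>" using L0 \<mu>0 by simp
  have \<rho>: "0 < \<rho>" "\<rho> \<le> 1" "\<rho> * (1 + L / \<mu>) \<le> \<epsilon>"
  proof -
    show "0 < \<rho>" "\<rho> \<le> 1"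
      using LM \<epsilon> by (auto simp: \<rho>_def intro!: divide_pos_pos)
    have "\<rho> \<le> \<epsilon> / (1 + L / \<mu>)" by (simp add: \<rho>_def)
    then show "\<rho> * (1 + L / \<mu>) \<le> \<epsilon>"
      using LM by (simp only: pos_le_divide_eq add_pos_pos zero_less_one)
  qed
  have "\<rho> * 1 \<le> \<rho> * (1 + L / \<mu>)"
    using LM \<rho> by (intro mult_left_mono) auto
  then have \<rho>\<epsilon>: "\<rho> \<le> \<epsilon>" using \<rho>(3) by linarith
  define r where "r = \<rho> * \<mu> / 2"
  have r: "0 < r" "2 * r = \<rho> * \<mu>" using \<rho> \<mu>0 by (auto simp: r_def)
  define y where "y = (\<lambda>s j. if j \<in> {1..l} then a s j else 0)"
  have y_lp: "y s \<in> lp p" for s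
    by (rule finite_support_in_lp[of _ l]) (auto simp: y_def)
  let ?A0 = "{n. 1 \<le> n \<and> (\<forall>s\<in>{1..N}. lp_dist p (y s) ((weighted_shift (w s) ^^ n) x) < r)}"
  have "window_dense Os ?A0"
    by (intro ret y_lp r(1))
  then obtain A where A: "A \<subseteq> ?A0" "window_dense Os A" "\<And>m n. m \<in> A \<Longrightarrow> n \<in> A \<Longrightarrow> n < m \<Longrightarrow> n + l \<le> m"
    using window_dense_thin[OF _ l] by blast
  have A_ret: "lp_dist p (y s) ((weighted_shift (w s) ^^ n) x) < r" if "n \<in> A" "s \<in> {1..N}" for n s
    using A(1) that by blast
  define z where "z = (\<lambda>s n q. y s q - (weighted_shift (w s) ^^ n) x q)"
  have z_lp: "z s n \<in> lp p" if "s \<in> {1..N}" for s n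
    unfolding z_def by (intro lp_diff_closed[OF p] y_lp weighted_shift_power_in_lp p x w that)
  have z_norm: "lp_norm p (z s n) < r" if "s \<in> {1..N}" "n \<in> A" for s n
    using A_ret[OF that(2,1)] by (simp add: lp_dist_def z_def)
  have coord: "norm (weight_prod (w s) j n * x (j + n) - a s j) \<le> r"
    if "s \<in> {1..N}" "n \<in> A" "j \<in> {1..l}" for s n j
    using norm_coord_le_lp_norm[OF p z_lp[OF that(1)], of j n] z_norm[OF that(1,2)] that(3)
    by (simp add: z_def y_def weighted_shift_power norm_minus_commute)
  have low: "\<mu> / 2 \<le> norm (weight_prod (w s) j n * x (j + n))" if "s \<in> {1..N}" "n \<in> A" "j \<in> {1..l}" for s n j
    using norm_divide_diff_le(1)[OF coord[OF that] coord[OF that] \<mu>L(1)[OF that(1,3)] \<mu>L(1)[OF that(1,3)]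
        \<mu>L(2)[OF that(1,3)] r(2) \<rho>(2) \<mu>0] .
  have ratio: "norm (weight_prod (w s) j n / weight_prod (w t) j n - a s j / a t j) \<le> \<epsilon>"
    if "s \<in> {1..N}" "t \<in> {1..N}" "n \<in> A" "j \<in> {1..l}" for s t n j
  proof -
    have "x (j + n) \<noteq> 0"
      using low[OF that(1,3,4)] \<mu>0 by auto
    then show ?thesis
      using norm_divide_diff_le(2)[OF coord[OF that(1,3,4)] coord[OF that(2,3,4)] \<mu>L(1)[OF that(1,4)]
          \<mu>L(1)[OF that(2,4)] \<mu>L(2)[OF that(1,4)] r(2) \<rho>(2) \<mu>0] \<rho>(3) by simp
  qed
  have tail: "(\<Sum>\<^sub>\<infinity>m\<in>{m \<in> A. m > n}. ennreal (norm (weight_prod (w s) (j + m - n) n) powr p) /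
            ennreal (norm (weight_prod (w t) j m) powr p)) \<le> ennreal \<epsilon>"
    if s: "s \<in> {1..N}" and t: "t \<in> {1..N}" and n: "n \<in> A" and j: "j \<in> {1..l}" for s t n j
  proof (rule finite_sums_le_imp_infsum_ennreal_le)
    show "0 < norm (weight_prod (w t) j m) powr p" if "m \<in> {m \<in> A. n < m}" for m
      using low[OF t _ j, of m] that \<mu>0 by auto
    fix G assume G: "finite G" "G \<subseteq> {m \<in> A. n < m}"
    have term_le: "norm (weight_prod (w s) (j + m - n) n) powr p / norm (weight_prod (w t) j m) powr p
        \<le> (2 / \<mu>) powr p * norm (z s n (j + m - n)) powr p" if "m \<in> G" for m
    proof -
      have m: "m \<in> A" "n < m" using G that by auto
      have "n + l \<le> m" by (rule A(3)[OF m(1) n m(2)])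
      then have "z s n (j + m - n) = - (weight_prod (w s) (j + m - n) n * x (j + m))"
        using m j by (auto simp: z_def y_def weighted_shift_power)
      then have "norm (weight_prod (w s) (j + m - n) n) * norm (x (j + m)) = norm (z s n (j + m - n))"
        by (simp add: norm_mult)
      moreover have lo: "\<mu> / 2 \<le> norm (weight_prod (w t) j m) * norm (x (j + m))"
        using low[OF t m(1) j] by (simp add: norm_mult)
      moreover have "norm (weight_prod (w s) (j + m - n) n) * (\<mu> / 2) \<le>
          norm (weight_prod (w s) (j + m - n) n) * (norm (weight_prod (w t) j m) * norm (x (j + m)))"
        by (intro mult_left_mono lo) simp
      ultimately have "norm (weight_prod (w s) (j + m - n) n) * (\<mu> / 2) \<le>
          norm (z s n (j + m - n)) * norm (weight_prod (w t) j m)"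
        by (metis mult.assoc mult.commute)
      moreover have "0 < norm (weight_prod (w t) j m)"
        using lo \<mu>0 by auto
      ultimately have "norm (weight_prod (w s) (j + m - n) n) / norm (weight_prod (w t) j m)
          \<le> 2 / \<mu> * norm (z s n (j + m - n))"
        using \<mu>0 by (simp add: field_simps)
      then have "(norm (weight_prod (w s) (j + m - n) n) / norm (weight_prod (w t) j m)) powr p
          \<le> (2 / \<mu> * norm (z s n (j + m - n))) powr p"
        using p by (intro powr_mono2) auto
      then show ?thesis
        using \<mu>0 by (simp add: powr_divide powr_mult)
    qed
    have "(\<Sum>m\<in>G. norm (weight_prod (w s) (j + m - n) n) powr p / norm (weight_prod (w t) j m) powr p)
        \<le> (2 / \<mu>) powr p * (\<Sum>m\<in>G. norm (z s n (j + m - n)) powr p)"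
      unfolding sum_distrib_left by (rule sum_mono[OF term_le])
    also have "(\<Sum>m\<in>G. norm (z s n (j + m - n)) powr p) = (\<Sum>q\<in>(\<lambda>m. j + m - n) ` G. norm (z s n q) powr p)"
      using G(2) by (subst sum.reindex) (auto intro!: inj_onI simp: eq_diff_iff)
    also have "\<dots> \<le> lp_norm p (z s n) powr p"
      using G j by (intro sum_le_lp_norm p z_lp s) auto
    also have "\<dots> \<le> r powr p"
      using z_norm[OF s n] p by (intro powr_mono2) (auto simp: lp_norm_def)
    also have "(2 / \<mu>) powr p * r powr p = \<rho> powr p"
      using r \<mu>0 \<rho> by (subst powr_mult[symmetric]) (auto simp: r_def)
    also have "\<rho> powr p \<le> \<rho> powr 1"
      using \<rho> p by (intro powr_mono') auto
    also have "\<dots> \<le> \<epsilon>" using \<rho> \<rho>\<epsilon> by simp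
    finally show "(\<Sum>m\<in>G. norm (weight_prod (w s) (j + m - n) n) powr p / norm (weight_prod (w t) j m) powr p) \<le> \<epsilon>"
      by (simp add: mult_left_mono)
  qed (use \<epsilon> in auto)
  show ?thesis
    using A(2) ratio tail by blast
qed

section \<open>A vector with prescribed return times\<close>

text \<open>
  The first operator serves as reference: \<open>c m j\<close> is the entry that has to stand at position \<open>m + j\<close>
  for the \<open>m\<close>-th iterate of that operator to show \<open>a\<^sub>1\<^sub>j\<close> at position \<open>j\<close>. For \<open>s \<noteq> 1\<close> both estimates are the
  comparison condition multiplied by \<open>\<bar>a\<^sub>1\<^sub>j\<bar>\<^sup>p\<close>. For \<open>s = 1\<close> the first error vanishes, and
  \<open>W\<^sup>1\<^sub>j\<^sub>+\<^sub>m\<^sub>-\<^sub>n\<^sub>,\<^sub>n c m j = c (m - n) j\<close>, so the second one is a tail of a convergent series as soon as the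
  gaps of \<open>B\<close> are large.
\<close>

lemma single_target_return_set:
  fixes w :: "nat \<Rightarrow> nat \<Rightarrow> 'a::real_normed_field" and a :: "nat \<Rightarrow> nat \<Rightarrow> 'a"
  defines "c \<equiv> \<lambda>m j. a 1 j / weight_prod (w 1) j m"
  assumes p: "1 \<le> p"
    and nz: "\<And>j n. 1 \<le> j \<Longrightarrow> weight_prod (w 1) j n \<noteq> 0"
    and sm: "\<And>j. 1 \<le> j \<Longrightarrow> summable (\<lambda>n. 1 / norm (weight_prod (w 1) j n) powr p)"
    and a: "\<And>j. j \<in> {1..l} \<Longrightarrow> a 1 j \<noteq> 0" and \<tau>: "0 < \<tau>"
    and comp: "\<And>\<epsilon>. 0 < \<epsilon> \<Longrightarrow> \<exists>A. window_dense Os A \<and> (\<forall>s\<in>{1..N}. s \<noteq> 1 \<longrightarrow> (\<forall>n\<in>A. \<forall>j\<in>{1..l}.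
       (\<forall>G. finite G \<and> G \<subseteq> {m \<in> A. n < m} \<longrightarrow> (\<Sum>m\<in>G. norm (weight_prod (w s) (j + m - n) n) powr p /
          norm (weight_prod (w 1) j m) powr p) \<le> \<epsilon>) \<and>
       norm (weight_prod (w s) j n / weight_prod (w 1) j n - a s j / a 1 j) \<le> \<epsilon>))"
  shows "\<exists>B. window_dense Os B \<and> (\<forall>n\<in>B. \<forall>m\<in>B. n < m \<longrightarrow> n + l < m) \<and> (\<forall>n\<in>B. \<forall>s\<in>{1..N}.
      (\<Sum>j=1..l. norm (weight_prod (w s) j n * c n j - a s j) powr p) \<le> \<tau> \<and>
      (\<forall>G. finite G \<and> G \<subseteq> {m \<in> B. n < m} \<longrightarrow>
        (\<Sum>m\<in>G. \<Sum>j=1..l. norm (weight_prod (w s) (j + m - n) n * c m j) powr p) \<le> \<tau>))"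
proof -
  \<comment> \<open>Since \<open>\<epsilon> \<le> 1\<close>, also \<open>\<epsilon>\<^sup>p \<le> \<epsilon>\<close>, and one choice of \<open>\<epsilon>\<close> serves both estimates.\<close>
  define H where "H = (\<Sum>j=1..l. norm (a 1 j) powr p) + 1"
  have H: "1 \<le> H" by (simp add: H_def sum_nonneg)
  define \<epsilon> where "\<epsilon> = min 1 (\<tau> / H)"
  have \<epsilon>: "0 < \<epsilon>" "\<epsilon> \<le> 1" "\<epsilon> * H \<le> \<tau>"
  proof -
    show "0 < \<epsilon>" "\<epsilon> \<le> 1" using \<tau> H by (auto simp: \<epsilon>_def)
    have "\<epsilon> \<le> \<tau> / H" by (simp add: \<epsilon>_def)
    then show "\<epsilon> * H \<le> \<tau>" using H by (simp add: pos_le_divide_eq)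
  qed
  have scaled: "\<epsilon> * (\<Sum>j=1..l. norm (a 1 j) powr p) \<le> \<tau>"
    using \<epsilon> by (simp add: H_def distrib_left)
  obtain A where A: "window_dense Os A"
    and tail: "\<And>s n j G. s \<in> {1..N} \<Longrightarrow> s \<noteq> 1 \<Longrightarrow> n \<in> A \<Longrightarrow> j \<in> {1..l} \<Longrightarrow> finite G \<Longrightarrow> G \<subseteq> {m \<in> A. n < m} \<Longrightarrow>
       (\<Sum>m\<in>G. norm (weight_prod (w s) (j + m - n) n) powr p / norm (weight_prod (w 1) j m) powr p) \<le> \<epsilon>"
    and ratio: "\<And>s n j. s \<in> {1..N} \<Longrightarrow> s \<noteq> 1 \<Longrightarrow> n \<in> A \<Longrightarrow> j \<in> {1..l} \<Longrightarrow>
       norm (weight_prod (w s) j n / weight_prod (w 1) j n - a s j / a 1 j) \<le> \<epsilon>"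
    using comp[OF \<epsilon>(1)] by (elim exE conjE) blast
  define f where "f = (\<lambda>m. \<Sum>j=1..l. norm (c m j) powr p)"
  have f: "summable f" "\<And>m. 0 \<le> f m"
  proof -
    have "summable (\<lambda>m. norm (a 1 j) powr p * (1 / norm (weight_prod (w 1) j m) powr p))" if "j \<in> {1..l}" for j
      using that by (intro summable_mult sm) auto
    then show "summable f"
      unfolding f_def by (intro summable_sum) (auto simp: c_def norm_divide powr_divide)
  qed (simp add: f_def sum_nonneg)
  obtain M where M: "\<And>G. finite G \<Longrightarrow> G \<subseteq> {M..} \<Longrightarrow> sum f G \<le> \<tau>"
    using summable_small_finite_tails[OF f \<tau>] by blast
  \<comment> \<open>Gaps above \<open>M\<close> put all differences into the small tail, gaps above \<open>l\<close> keep the blocks apart.\<close>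
  obtain B where B: "B \<subseteq> A" "window_dense Os B" "\<And>m n. m \<in> B \<Longrightarrow> n \<in> B \<Longrightarrow> n < m \<Longrightarrow> n + (M + l + 1) \<le> m"
    using window_dense_thin[OF A, of "M + l + 1"] by auto
  have diag: "(\<Sum>j=1..l. norm (weight_prod (w s) j n * c n j - a s j) powr p) \<le> \<tau>"
    if n: "n \<in> B" and s: "s \<in> {1..N}" for n s
  proof (cases "s = 1")
    case True
    then have "(\<Sum>j=1..l. norm (weight_prod (w s) j n * c n j - a s j) powr p) = (\<Sum>j=1..l. 0)"
      using nz by (intro sum.cong) (auto simp: c_def)
    then show ?thesis using \<tau> by simp
  next
    case False
    have "norm (weight_prod (w s) j n * c n j - a s j) powr p \<le> \<epsilon> * norm (a 1 j) powr p" if j: "j \<in> {1..l}" for j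
    proof -
      have "weight_prod (w s) j n * c n j - a s j =
          (weight_prod (w s) j n / weight_prod (w 1) j n - a s j / a 1 j) * a 1 j"
        using a[OF j] by (simp add: c_def left_diff_distrib)
      then have "norm (weight_prod (w s) j n * c n j - a s j) \<le> \<epsilon> * norm (a 1 j)"
        using ratio[OF s False _ j, of n] n B(1) by (auto simp: norm_mult intro!: mult_right_mono)
      then have "norm (weight_prod (w s) j n * c n j - a s j) powr p \<le> (\<epsilon> * norm (a 1 j)) powr p"
        using p by (intro powr_mono2) auto
      also have "\<dots> = \<epsilon> powr p * norm (a 1 j) powr p"
        using \<epsilon> by (simp add: powr_mult)
      also have "\<epsilon> powr p \<le> \<epsilon> powr 1"
        using \<epsilon> p by (intro powr_mono') auto
      finally show ?thesis using \<epsilon> by (simp add: mult_right_mono)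
    qed
    then have "(\<Sum>j=1..l. norm (weight_prod (w s) j n * c n j - a s j) powr p) \<le> (\<Sum>j=1..l. \<epsilon> * norm (a 1 j) powr p)"
      by (rule sum_mono)
    then show ?thesis
      using scaled by (simp add: sum_distrib_left)
  qed
  have off: "(\<Sum>m\<in>G. \<Sum>j=1..l. norm (weight_prod (w s) (j + m - n) n * c m j) powr p) \<le> \<tau>"
    if n: "n \<in> B" and s: "s \<in> {1..N}" and G: "finite G" "G \<subseteq> {m \<in> B. n < m}" for n s G
  proof (cases "s = 1")
    case True
    have "norm (weight_prod (w s) (j + m - n) n * c m j) = norm (c (m - n) j)" if "m \<in> G" "j \<in> {1..l}" for m j
    proof -
      have m: "n < m" using G that by auto
      have "weight_prod (w 1) j m = weight_prod (w 1) j (m - n) * weight_prod (w 1) (j + m - n) n"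
        using weight_prod_add[of "w 1" j "m - n" n] m by simp
      then show ?thesis
        using nz[of j m] that True by (simp add: c_def norm_mult norm_divide)
    qed
    then have "(\<Sum>m\<in>G. \<Sum>j=1..l. norm (weight_prod (w s) (j + m - n) n * c m j) powr p) = (\<Sum>m\<in>G. f (m - n))"
      by (simp add: f_def)
    also have "\<dots> = (\<Sum>h\<in>(\<lambda>m. m - n) ` G. f h)"
      using G(2) by (subst sum.reindex) (auto intro!: inj_onI simp: eq_diff_iff)
    also have "\<dots> \<le> \<tau>"
    proof (rule M)
      show "(\<lambda>m. m - n) ` G \<subseteq> {M..}"
        using B(3)[OF _ n] G(2) by fastforce
    qed (use G in simp)
    finally show ?thesis .
  next
    case False
    have "(\<Sum>m\<in>G. \<Sum>j=1..l. norm (weight_prod (w s) (j + m - n) n * c m j) powr p) =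
        (\<Sum>j=1..l. norm (a 1 j) powr p * (\<Sum>m\<in>G. norm (weight_prod (w s) (j + m - n) n) powr p /
          norm (weight_prod (w 1) j m) powr p))"
      by (subst sum.swap) (simp add: sum_distrib_left c_def norm_mult norm_divide powr_mult powr_divide mult_ac)
    also have "\<dots> \<le> (\<Sum>j=1..l. norm (a 1 j) powr p * \<epsilon>)"
      using n s G B(1) False by (intro sum_mono mult_left_mono tail) auto
    also have "\<dots> \<le> \<tau>"
      using scaled by (simp add: sum_distrib_left mult.commute)
    finally show ?thesis .
  qed
  show ?thesis
  proof (intro exI[of _ B] conjI ballI impI allI)
    show "n + l < m" if "n \<in> B" "m \<in> B" "n < m" for n m
      using B(3)[OF that(2,1,3)] by simp
  qed (use B(2) diag off in auto)
qed

text \<open>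
  The piece \<open>E i\<close> is cut out of \<open>B i\<close> far to the right; \<open>P i\<close> bounds everything used up to step \<open>i\<close>.
  Since \<open>P i\<close> is known before the next piece is chosen, the factor \<open>C ^ P i\<close> can be compensated by the
  tail of the convergent series \<open>f (Suc i)\<close>.
\<close>

lemma separated_windows:
  fixes f :: "nat \<Rightarrow> nat \<Rightarrow> real" and l :: "nat \<Rightarrow> nat" and C :: real
  assumes dense: "\<And>i K L. \<exists>M\<ge>K. \<exists>k\<in>Os. \<delta> i * real M \<le> real (card (B i \<inter> {L..} \<inter> {k+1..k+M}))"
    and f: "\<And>i. summable (f i)" "\<And>i m. 0 \<le> f i m" and C: "1 \<le> C"
  obtains E P where "\<And>i. E i \<subseteq> B i" "\<And>i. finite (E i)"
    "\<And>i. \<exists>M\<ge>i. \<exists>k\<in>Os. \<delta> i * real M \<le> real (card (E i \<inter> {k+1..k+M}))"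
    "\<And>i m. m \<in> E i \<Longrightarrow> m + l i < P i" "\<And>i. E (Suc i) \<subseteq> {P i..}" "\<And>i. P i \<le> P (Suc i)"
    "\<And>i. C ^ P i * (\<Sum>m\<in>E (Suc i). f (Suc i) m) \<le> (1/2) ^ Suc i"
proof -
  define Q where "Q = (\<lambda>i (E, P). E \<subseteq> B i \<and> finite E \<and>
    (\<exists>M\<ge>i. \<exists>k\<in>Os. \<delta> i * real M \<le> real (card (E \<inter> {k+1..k+M}))) \<and> (\<forall>m\<in>E. m + l i < P))"
  define R where "R = (\<lambda>i (E :: nat set, P) (E', P'). E' \<subseteq> {P..} \<and> P \<le> P' \<and>
     C ^ P * (\<Sum>m\<in>E'. f (Suc i) m) \<le> (1/2) ^ Suc i)"
  have step: "\<exists>E P'. Q i (E, P') \<and> E \<subseteq> {L..} \<and> P \<le> P'" for i L P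
  proof -
    obtain M k where M: "M \<ge> i" "k \<in> Os" "\<delta> i * real M \<le> real (card (B i \<inter> {L..} \<inter> {k+1..k+M}))"
      using dense by blast
    define E where "E = B i \<inter> {L..} \<inter> {k+1..k+M}"
    have "Q i (E, P + k + M + l i + 1)"
      using M unfolding Q_def by (auto simp: E_def Int_assoc intro!: exI[of _ M] bexI[of _ k])
    then show ?thesis
      by (intro exI[of _ E] exI[of _ "P + k + M + l i + 1"]) (auto simp: E_def)
  qed
  have "\<exists>Z. \<forall>i. Q i (Z i) \<and> R i (Z i) (Z (Suc i))"
  proof (rule dependent_nat_choice)
    show "\<exists>X. Q 0 X" using step by blast
    fix X i assume "Q i X"
    obtain E P where X: "X = (E, P)" by (cases X)
    have "0 < (1/2) ^ Suc i / C ^ P" using C by simp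
    then obtain M where M: "\<And>G. finite G \<Longrightarrow> G \<subseteq> {M..} \<Longrightarrow> sum (f (Suc i)) G \<le> (1/2) ^ Suc i / C ^ P"
      using summable_small_finite_tails[OF f] by blast
    obtain E' P' where E': "Q (Suc i) (E', P')" "E' \<subseteq> {max M P..}" "P \<le> P'"
      using step by blast
    have "sum (f (Suc i)) E' \<le> (1/2) ^ Suc i / C ^ P"
      using E' by (intro M) (auto simp: Q_def)
    then have "C ^ P * sum (f (Suc i)) E' \<le> (1/2) ^ Suc i"
      using C by (simp add: field_simps)
    then have "R i X (E', P')"
      using E' by (auto simp: R_def X)
    then show "\<exists>Y. Q (Suc i) Y \<and> R i X Y"
      using E'(1) by blast
  qed
  then obtain Z where Z: "\<And>i. Q i (Z i)" "\<And>i. R i (Z i) (Z (Suc i))" by blast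
  show thesis
    by (rule that[of "\<lambda>i. fst (Z i)" "\<lambda>i. snd (Z i)"])
      (use Z in \<open>auto simp: Q_def R_def split_beta\<close>)
qed

lemma sum_half_powers_le: "(\<Sum>i\<in>{k<..K}. (1/2::real) ^ i) \<le> (1/2) ^ k"
proof (cases "k \<le> K")
  case True
  have "(\<Sum>i\<in>{k<..K}. (1/2::real) ^ i) = (1/2) ^ k - (1/2) ^ K"
    using True
  proof (induction K rule: dec_induct)
    case (step K)
    then have "{k<..Suc K} = insert (Suc K) {k<..K}" by auto
    then show ?case using step by simp
  qed simp
  then show ?thesis by simp
qed simp

text \<open>
  Blocks \<open>c i m 1, \<dots>, c i m (l i)\<close> are written at the positions \<open>m + 1, \<dots>, m + l i\<close>, for every \<open>i\<close> and
  every \<open>m \<in> E i\<close>. The gaps make these positions pairwise distinct, so sums over entries of \<open>x\<close> become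
  sums over triples \<open>(i, m, j)\<close>. At time \<open>n \<in> E k\<close> the first \<open>l k\<close> entries show the block written at \<open>n\<close>
  (hypothesis \<open>diag\<close>); every other visible triple has \<open>m > n\<close> and either \<open>i = k\<close> (hypothesis \<open>off\<close>) or
  \<open>i > k\<close>, where \<open>n\<close> shifts cost at most \<open>C\<^sup>n\<close> (hypothesis \<open>small\<close>).
\<close>

lemma vector_from_windows:
  fixes w :: "nat \<Rightarrow> nat \<Rightarrow> 'a::real_normed_field" and c :: "nat \<Rightarrow> nat \<Rightarrow> nat \<Rightarrow> 'a"
    and y :: "nat \<Rightarrow> nat \<Rightarrow> nat \<Rightarrow> 'a"
  assumes p: "1 \<le> p"
    and C: "1 \<le> C" "\<And>s n. s \<in> {1..N} \<Longrightarrow> 1 \<le> n \<Longrightarrow> norm (w s n) \<le> C"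
    and fin: "\<And>i. finite (E i)" and gap: "\<And>i m n. m \<in> E i \<Longrightarrow> n \<in> E i \<Longrightarrow> n < m \<Longrightarrow> n + l i < m"
    and P: "\<And>i m. m \<in> E i \<Longrightarrow> m + l i < P i" "\<And>i. E (Suc i) \<subseteq> {P i..}" "\<And>i. P i \<le> P (Suc i)"
    and small: "\<And>i. (C powr p) ^ P i * (\<Sum>m\<in>E (Suc i). \<Sum>j=1..l (Suc i). norm (c (Suc i) m j) powr p) \<le> (1/2) ^ Suc i"
    and y: "\<And>i s q. q \<notin> {1..l i} \<Longrightarrow> y i s q = 0"
    and diag: "\<And>i n s. n \<in> E i \<Longrightarrow> s \<in> {1..N} \<Longrightarrow>
      (\<Sum>j=1..l i. norm (weight_prod (w s) j n * c i n j - y i s j) powr p) \<le> \<tau> i"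
    and off: "\<And>i n s. n \<in> E i \<Longrightarrow> s \<in> {1..N} \<Longrightarrow>
      (\<Sum>m\<in>{m \<in> E i. n < m}. \<Sum>j=1..l i. norm (weight_prod (w s) (j + m - n) n * c i m j) powr p) \<le> \<tau> i"
  obtains x where "x \<in> lp p"
    "\<And>i n s F. n \<in> E i \<Longrightarrow> s \<in> {1..N} \<Longrightarrow> finite F \<Longrightarrow> F \<subseteq> {1..} \<Longrightarrow>
      (\<Sum>q\<in>F. norm ((weighted_shift (w s) ^^ n) x q - y i s q) powr p) \<le> 2 * \<tau> i + (1/2) ^ i"
proof -
  define J where "J = (SIGMA i:UNIV. SIGMA m:E i. {1..l i})"
  define \<phi> where "\<phi> = (\<lambda>(i::nat, m::nat, j::nat). m + j)"
  define d where "d = (\<lambda>(i, m, j). c i m j)"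
  have P_mono: "P i \<le> P i'" if "i \<le> i'" for i i'
    using P(3) that by (rule lift_Suc_mono_le)
  have later: "P i \<le> m" if ii: "i < i'" "m \<in> E i'" for i i' m
  proof -
    obtain i'' where i'': "i' = Suc i''" "i \<le> i''" using ii(1) by (cases i') auto
    then have "P i'' \<le> m" using P(2)[of i''] ii by auto
    then show ?thesis using P_mono[OF i''(2)] by simp
  qed
  have inj: "inj_on \<phi> J"
  proof (rule inj_onI)
    fix t t' assume t: "t \<in> J" "t' \<in> J" "\<phi> t = \<phi> t'"
    obtain i m j i' m' j' where tt: "t = (i, m, j)" "t' = (i', m', j')"
      by (metis prod_cases3)
    have J: "m \<in> E i" "j \<in> {1..l i}" "m' \<in> E i'" "j' \<in> {1..l i'}" "m + j = m' + j'"
      using t by (auto simp: tt J_def \<phi>_def)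
    have "\<not> i < i'"
      using later[of i i' m'] P(1)[OF J(1)] J by auto
    moreover have "\<not> i' < i"
      using later[of i' i m] P(1)[OF J(3)] J by auto
    ultimately have i: "i = i'" by simp
    have "\<not> m < m'" "\<not> m' < m"
      using gap[of m' i m] gap[of m i m'] J i by auto
    then show "t = t'" using J i by (simp add: tt)
  qed
  \<comment> \<open>The entry at an occupied position is the coefficient of its unique triple.\<close>
  define x where "x = (\<lambda>q. if q \<in> \<phi> ` J then d (the_inv_into J \<phi> q) else 0)"
  have x_on: "x (\<phi> t) = d t" if "t \<in> J" for t
    using that by (simp add: x_def the_inv_into_f_f[OF inj])
  have x_off: "x q = 0" if "q \<notin> \<phi> ` J" for q
    using that by (simp add: x_def)
  have x_off': "x q = 0" if "q \<in> F" "q \<notin> \<phi> ` (J \<inter> \<phi> -` F)" for q F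
    using that by (intro x_off) auto
  have fin_pre: "finite (J \<inter> \<phi> -` F)" if "finite F" for F
    using finite_vimage_IntI[OF that inj] by (simp add: Int_commute)
  have sum_J_le: "(\<Sum>t\<in>T. g t) \<le> (\<Sum>i\<in>I. \<Sum>m\<in>E' i. \<Sum>j=1..l i. g (i, m, j))"
    if "finite T" "\<And>i m j. (i, m, j) \<in> T \<Longrightarrow> i \<in> I \<and> m \<in> E' i \<and> j \<in> {1..l i}" "finite I" "\<And>i. E' i \<subseteq> E i" "\<And>t. 0 \<le> g t"
    for T I E' and g :: "nat \<times> nat \<times> nat \<Rightarrow> real"
  proof -
    have finE': "finite (E' i)" for i
      using that(4) fin by (rule finite_subset)
    have "(\<Sum>t\<in>T. g t) \<le> (\<Sum>t\<in>(SIGMA i:I. SIGMA m:E' i. {1..l i}). g t)"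
      using that finE' by (intro sum_mono2) (auto intro!: finite_SigmaI)
    also have "\<dots> = (\<Sum>i\<in>I. \<Sum>t\<in>E' i \<times> {1..l i}. g (i, t))"
      using sum.Sigma[of I "\<lambda>i. E' i \<times> {1..l i}" "\<lambda>i t. g (i, t)"] that(3) finE'
      by (simp add: case_prod_unfold)
    also have "\<dots> = (\<Sum>i\<in>I. \<Sum>m\<in>E' i. \<Sum>j=1..l i. g (i, m, j))"
      by (simp add: sum.cartesian_product case_prod_unfold)
    finally show ?thesis .
  qed
  let ?f = "\<lambda>i m. \<Sum>j=1..l i. norm (c i m j) powr p"
  have Cp: "1 \<le> C powr p" using C(1) p by (simp add: ge_one_powr_ge_zero)
  have small1: "(C powr p) ^ n * (\<Sum>m\<in>E i. ?f i m) \<le> (1/2) ^ i" if "k < i" "n \<le> P k" for i k n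
  proof -
    obtain i' where i': "i = Suc i'" "k \<le> i'" using \<open>k < i\<close> by (cases i) auto
    have "(C powr p) ^ n * (\<Sum>m\<in>E i. ?f i m) \<le> (C powr p) ^ P i' * (\<Sum>m\<in>E i. ?f i m)"
      using Cp that P_mono[OF i'(2)] by (intro mult_right_mono power_increasing sum_nonneg) auto
    then show ?thesis using small[of i'] i' by simp
  qed
  have x_lp: "x \<in> lp p"
  proof (rule lp_bounded_sumsI(1)[OF p])
    show "x 0 = 0"
      by (rule x_off) (auto simp: J_def \<phi>_def)
    fix F :: "nat set" assume F: "finite F"
    define T where "T = J \<inter> \<phi> -` F"
    have T: "finite T" "T \<subseteq> J" using fin_pre[OF F] by (auto simp: T_def)
    define K where "K = Max (insert 0 (fst ` T))"
    have K: "i \<le> K" if "(i, m, j) \<in> T" for i m j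
      unfolding K_def using T(1) that by (intro Max_ge) force+
    have "(\<Sum>q\<in>F. norm (x q) powr p) = (\<Sum>q\<in>\<phi> ` T. norm (x q) powr p)"
      unfolding T_def by (intro sum.mono_neutral_right) (use F x_off'[of _ F] in auto)
    also have "\<dots> = (\<Sum>t\<in>T. norm (d t) powr p)"
      using inj_on_subset[OF inj T(2)] T(2) by (subst sum.reindex) (auto intro!: sum.cong simp: x_on)
    also have "\<dots> \<le> (\<Sum>i\<in>{..K}. \<Sum>m\<in>E i. \<Sum>j=1..l i. norm (d (i, m, j)) powr p)"
      using T K by (intro sum_J_le) (auto simp: J_def)
    also have "\<dots> = (\<Sum>i\<in>{..K}. \<Sum>m\<in>E i. ?f i m)"
      by (simp add: d_def)
    also have "{..K} = insert 0 {0<..K}" by auto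
    also have "(\<Sum>i\<in>insert 0 {0<..K}. \<Sum>m\<in>E i. ?f i m) = (\<Sum>m\<in>E 0. ?f 0 m) + (\<Sum>i\<in>{0<..K}. \<Sum>m\<in>E i. ?f i m)"
      by simp
    also have "(\<Sum>i\<in>{0<..K}. \<Sum>m\<in>E i. ?f i m) \<le> (\<Sum>i\<in>{0<..K}. (1/2) ^ i)"
      using small1[of 0 _ 0] by (intro sum_mono) auto
    also have "\<dots> \<le> (1/2) ^ 0" by (rule sum_half_powers_le)
    finally show "(\<Sum>q\<in>F. norm (x q) powr p) \<le> (\<Sum>m\<in>E 0. ?f 0 m) + (1/2) ^ 0" by simp
  qed
  have "(\<Sum>q\<in>F. norm ((weighted_shift (w s) ^^ n) x q - y k s q) powr p) \<le> 2 * \<tau> k + (1/2) ^ k"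
    if n: "n \<in> E k" and s: "s \<in> {1..N}" and F: "finite F" "F \<subseteq> {1..}" for k n s F
  proof -
    let ?z = "\<lambda>q. norm ((weighted_shift (w s) ^^ n) x q - y k s q) powr p"
    have z: "?z q = norm (weight_prod (w s) q n * x (q + n) - y k s q) powr p" if "1 \<le> q" for q
      using that by (simp add: weighted_shift_power)
    have nP: "n < P k" using P(1)[OF n] by simp
    have "(\<Sum>q\<in>F \<inter> {1..l k}. ?z q) \<le> (\<Sum>q=1..l k. ?z q)"
      by (intro sum_mono2) auto
    also have "\<dots> = (\<Sum>q=1..l k. norm (weight_prod (w s) q n * c k n q - y k s q) powr p)"
    proof (rule sum.cong[OF refl])
      fix q assume q: "q \<in> {1..l k}"
      have "x (q + n) = c k n q"
        using x_on[of "(k, n, q)"] n q by (simp add: J_def \<phi>_def d_def add.commute)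
      then show "?z q = norm (weight_prod (w s) q n * c k n q - y k s q) powr p"
        using q by (simp add: z)
    qed
    also have "\<dots> \<le> \<tau> k" by (rule diag[OF n s])
    finally have near: "(\<Sum>q\<in>F \<inter> {1..l k}. ?z q) \<le> \<tau> k" .
    define F' where "F' = F - {1..l k}"
    have F': "finite F'" "\<And>q. q \<in> F' \<Longrightarrow> l k < q" using F by (auto simp: F'_def)
    define T where "T = J \<inter> \<phi> -` ((\<lambda>q. q + n) ` F')"
    have T: "finite T" "T \<subseteq> J" using fin_pre[of "(\<lambda>q. q + n) ` F'"] F' by (auto simp: T_def)
    define K where "K = Max (insert k (fst ` T))"
    have K: "k \<le> K" "\<And>i m j. (i, m, j) \<in> T \<Longrightarrow> i \<le> K"
      unfolding K_def using T(1) by (auto intro!: Max_ge) (force intro: Max_ge)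
    define g where "g = (\<lambda>t. norm (weight_prod (w s) (\<phi> t - n) n * d t) powr p)"
    define E' where "E' = (\<lambda>i. {m \<in> E i. n < m})"
    \<comment> \<open>Earlier pieces end before \<open>n\<close>, and of the piece of \<open>n\<close> only blocks beyond the one at \<open>n\<close> are left.\<close>
    have T_after: "k \<le> i \<and> n < m" if t: "(i, m, j) \<in> T" for i m j
    proof -
      have J: "m \<in> E i" "j \<in> {1..l i}" "n + l k < m + j"
        using t F'(2) by (auto simp: T_def J_def \<phi>_def)
      have "\<not> i < k"
        using later[of i k n] P(1)[OF J(1)] J n by auto
      moreover have "n < m" if "i = k"
        using gap[of n k m] J n that by (cases m n rule: linorder_cases) auto
      moreover have "n < m" if "k < i"
        using later[OF that J(1)] nP by simp
      ultimately show ?thesis by (metis linorder_neqE_nat less_imp_le_nat order_refl)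
    qed
    have "(\<Sum>q\<in>F'. ?z q) = (\<Sum>q\<in>F'. norm (weight_prod (w s) q n * x (q + n)) powr p)"
    proof (rule sum.cong[OF refl])
      fix q assume "q \<in> F'"
      then have "1 \<le> q" "y k s q = 0"
        using F y by (auto simp: F'_def)
      then show "?z q = norm (weight_prod (w s) q n * x (q + n)) powr p"
        by (simp add: weighted_shift_power)
    qed
    also have "\<dots> = (\<Sum>v\<in>(\<lambda>q. q + n) ` F'. norm (weight_prod (w s) (v - n) n * x v) powr p)"
      by (subst sum.reindex) auto
    also have "\<dots> = (\<Sum>v\<in>\<phi> ` T. norm (weight_prod (w s) (v - n) n * x v) powr p)"
      unfolding T_def by (intro sum.mono_neutral_right) (use F' x_off'[of _ "(\<lambda>q. q + n) ` F'"] in auto)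
    also have "\<dots> = (\<Sum>t\<in>T. g t)"
      using inj_on_subset[OF inj T(2)] T(2) by (subst sum.reindex) (auto intro!: sum.cong simp: x_on g_def)
    also have "\<dots> \<le> (\<Sum>i\<in>{k..K}. \<Sum>m\<in>E' i. \<Sum>j=1..l i. g (i, m, j))"
      using T K T_after by (intro sum_J_le) (auto simp: J_def E'_def g_def)
    also have "{k..K} = insert k {k<..K}" using K(1) by auto
    also have "(\<Sum>i\<in>insert k {k<..K}. \<Sum>m\<in>E' i. \<Sum>j=1..l i. g (i, m, j)) =
        (\<Sum>m\<in>E' k. \<Sum>j=1..l k. g (k, m, j)) + (\<Sum>i\<in>{k<..K}. \<Sum>m\<in>E' i. \<Sum>j=1..l i. g (i, m, j))"
      by simp
    also have "(\<Sum>m\<in>E' k. \<Sum>j=1..l k. g (k, m, j)) \<le> \<tau> k"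
      using off[OF n s] by (simp add: E'_def g_def \<phi>_def d_def add.commute)
    also have "(\<Sum>i\<in>{k<..K}. \<Sum>m\<in>E' i. \<Sum>j=1..l i. g (i, m, j)) \<le> (\<Sum>i\<in>{k<..K}. (1/2) ^ i)"
    proof (rule sum_mono)
      fix i assume i: "i \<in> {k<..K}"
      have g_le: "g (i, m, j) \<le> (C powr p) ^ n * norm (c i m j) powr p" for m j
      proof -
        have "norm (weight_prod (w s) (m + j - n) n) powr p \<le> (C ^ n) powr p"
          using p C(2)[OF s] by (intro powr_mono2 norm_weight_prod_le) auto
        also have "\<dots> = (C powr p) ^ n"
          using C(1) by (simp add: powr_realpow[symmetric] powr_powr mult.commute)
        finally show ?thesis
          by (simp add: g_def \<phi>_def d_def norm_mult powr_mult mult_right_mono)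
      qed
      have "(\<Sum>m\<in>E' i. \<Sum>j=1..l i. g (i, m, j)) \<le> (\<Sum>m\<in>E i. \<Sum>j=1..l i. g (i, m, j))"
        using fin by (intro sum_mono2) (auto simp: E'_def g_def intro!: sum_nonneg)
      also have "\<dots> \<le> (\<Sum>m\<in>E i. \<Sum>j=1..l i. (C powr p) ^ n * norm (c i m j) powr p)"
        by (intro sum_mono g_le)
      also have "\<dots> = (C powr p) ^ n * (\<Sum>m\<in>E i. ?f i m)"
        by (simp add: sum_distrib_left)
      also have "\<dots> \<le> (1/2) ^ i"
        using i nP by (intro small1[of k]) auto
      finally show "(\<Sum>m\<in>E' i. \<Sum>j=1..l i. g (i, m, j)) \<le> (1/2) ^ i" .
    qed
    also have "\<dots> \<le> (1/2) ^ k" by (rule sum_half_powers_le)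
    finally have far: "(\<Sum>q\<in>F'. ?z q) \<le> \<tau> k + (1/2) ^ k" by simp
    have "(\<Sum>q\<in>F. ?z q) = (\<Sum>q\<in>F \<inter> {1..l k}. ?z q) + (\<Sum>q\<in>F'. ?z q)"
      unfolding F'_def by (rule sum.Int_Diff[OF F(1)])
    then show ?thesis using near far by linarith
  qed
  then show thesis using that[of x] x_lp by blast
qed

lemma countable_dense_nonzero:
  obtains D :: "'a::{real_normed_field, second_countable_topology} set"
  where "countable D" "0 \<notin> D" "\<And>v e. 0 < e \<Longrightarrow> \<exists>d\<in>D. norm (d - v) < e"
proof -
  obtain D :: "'a set" where D: "countable D" "\<And>X. open X \<Longrightarrow> X \<noteq> {} \<Longrightarrow> \<exists>d\<in>D. d \<in> X"
    using countable_dense_setE by blast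
  have "\<exists>d\<in>D - {0}. norm (d - v) < e" if e: "0 < e" for v e
  proof -
    have "(if v = 0 then of_real (e / 2) else v) \<in> ball v e - {0}"
      using e by (auto simp: dist_norm)
    then have "\<exists>d\<in>D. d \<in> ball v e - {0}"
      by (intro D(2)) (auto intro: open_delete)
    then show ?thesis
      by (auto simp: dist_norm norm_minus_commute)
  qed
  then show thesis
    using D(1) by (intro that[of "D - {0}"]) auto
qed

text \<open>
  A common length \<open>l\<close> is possible because finitely many vectors are approximated simultaneously. All
  of the first \<open>l\<close> coefficients are taken from \<open>D\<close>, hence may be required to be nonzero.
\<close>

lemma lp_approx_finite_support:
  fixes y :: "nat \<Rightarrow> nat \<Rightarrow> 'a::real_normed_field"
  assumes p: "1 \<le> p" and y: "\<And>s. s \<in> {1..N} \<Longrightarrow> y s \<in> lp p"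
    and D: "\<And>v e. 0 < e \<Longrightarrow> \<exists>d\<in>D. norm (d - v) < e" and e: "0 < e"
  shows "\<exists>l\<ge>1. \<exists>a\<in>PiE ({1..N} \<times> {1..l}) (\<lambda>_. D). \<forall>s\<in>{1..N}.
    lp_norm p (\<lambda>q. (if q \<in> {1..l} then a (s, q) else 0) - y s q) \<le> e"
proof -
  \<comment> \<open>One half of \<open>e\<^sup>p\<close> is spent on the first \<open>l\<close> entries, the other half on the tail.\<close>
  define E where "E = e powr p / 2"
  have E: "0 < E" using e by (simp add: E_def)
  have "\<exists>M. \<forall>G. finite G \<and> G \<subseteq> {M..} \<longrightarrow> (\<Sum>q\<in>G. norm (y s q) powr p) \<le> E" if s: "s \<in> {1..N}" for s
  proof -
    have "(\<lambda>q. norm (y s q) powr p) summable_on {1..}" "y s 0 = 0"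
      using y[OF s] by (auto simp: lp_def)
    then have "(\<lambda>q. norm (y s q) powr p) summable_on UNIV"
      by (elim summable_on_cong_neutral[THEN iffD1, rotated -1]) (auto simp: not_le)
    then have "summable (\<lambda>q. norm (y s q) powr p)"
      by (rule summable_on_imp_summable)
    then show ?thesis
      using summable_small_finite_tails[OF _ _ E] by (metis powr_ge_zero)
  qed
  then obtain M where M: "\<And>s G. s \<in> {1..N} \<Longrightarrow> finite G \<Longrightarrow> G \<subseteq> {M s..} \<Longrightarrow> (\<Sum>q\<in>G. norm (y s q) powr p) \<le> E"
    by metis
  define l where "l = Max (insert 1 (M ` {1..N}))"
  have l: "1 \<le> l" "\<And>s. s \<in> {1..N} \<Longrightarrow> M s \<le> l"
    unfolding l_def by (intro Max_ge; simp)+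
  define \<eta> where "\<eta> = (E / real l) powr (1 / p)"
  have \<eta>: "0 < \<eta>" "real l * \<eta> powr p = E"
    using E l(1) p by (auto simp: \<eta>_def powr_powr)
  obtain b where b: "\<And>s q. b s q \<in> D \<and> norm (b s q - y s q) < \<eta>"
  proof -
    have "\<exists>d. d \<in> D \<and> norm (d - y s q) < \<eta>" for s q
      using D[OF \<eta>(1), of "y s q"] by blast
    then show thesis using that by metis
  qed
  define a where "a = (\<lambda>t\<in>{1..N} \<times> {1..l}. b (fst t) (snd t))"
  have a: "a (s, q) = b s q" if "s \<in> {1..N}" "q \<in> {1..l}" for s q
    using that by (simp add: a_def)
  have "lp_norm p (\<lambda>q. (if q \<in> {1..l} then a (s, q) else 0) - y s q) \<le> e" if s: "s \<in> {1..N}" for s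
  proof -
    let ?z = "\<lambda>q. (if q \<in> {1..l} then a (s, q) else 0) - y s q"
    have "lp_norm p ?z \<le> (2 * E) powr (1 / p)"
    proof (rule lp_bounded_sumsI(2)[OF p])
      show "?z 0 = 0" using y[OF s] by (simp add: lp_def)
      fix F :: "nat set" assume F: "finite F" "F \<subseteq> {1..}"
      have "(\<Sum>q\<in>F \<inter> {1..l}. norm (?z q) powr p) \<le> (\<Sum>q\<in>F \<inter> {1..l}. \<eta> powr p)"
        using b p s by (intro sum_mono powr_mono2) (auto simp: a less_imp_le)
      also have "\<dots> \<le> real l * \<eta> powr p"
        using card_mono[of "{1..l}" "F \<inter> {1..l}"] by (auto intro!: mult_right_mono)
      also have "\<dots> = E" by (rule \<eta>)
      finally have 1: "(\<Sum>q\<in>F \<inter> {1..l}. norm (?z q) powr p) \<le> E" .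
      have "(\<Sum>q\<in>F - {1..l}. norm (?z q) powr p) = (\<Sum>q\<in>F - {1..l}. norm (y s q) powr p)"
        by (intro sum.cong) auto
      also have "\<dots> \<le> E"
        using F l(2)[OF s] by (intro M s) auto
      finally show "(\<Sum>q\<in>F. norm (?z q) powr p) \<le> 2 * E"
        using 1 sum.Int_Diff[OF F(1), of "\<lambda>q. norm (?z q) powr p" "{1..l}"] by linarith
    qed
    also have "\<dots> = e" using e p by (simp add: E_def powr_powr)
    finally show ?thesis .
  qed
  moreover have "a \<in> PiE ({1..N} \<times> {1..l}) (\<lambda>_. D)"
    using b by (auto simp: a_def)
  ultimately show ?thesis using l(1) by blast
qed

text \<open>
  A target \<open>u = (l, q, a)\<close> consists of a length, a tolerance \<open>1 / (q + 1)\<close> and coefficients from a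
  countable dense set without \<open>0\<close>. Visiting each of these countably many targets infinitely often
  makes every return set contain infinitely many of the windows chosen for one target, hence dense
  with that target's constant; discarding finitely many of them makes the error \<open>(1/2)\<^sup>i\<close> small.
\<close>

lemma disjoint_hypercyclic_of_comparison:
  fixes w :: "nat \<Rightarrow> nat \<Rightarrow> 'a::{real_normed_field, second_countable_topology}"
  assumes p: "1 \<le> p" and N: "1 \<le> N" and w: "\<And>s. s \<in> {1..N} \<Longrightarrow> bounded (w s ` {1..})"
    and nz: "\<And>j n. 1 \<le> j \<Longrightarrow> weight_prod (w 1) j n \<noteq> 0"
    and sm: "\<And>j. 1 \<le> j \<Longrightarrow> summable (\<lambda>n. 1 / norm (weight_prod (w 1) j n) powr p)"
    and comp: "\<And>l (a :: nat \<Rightarrow> nat \<Rightarrow> 'a) \<epsilon>. 1 \<le> l \<Longrightarrow> (\<And>s j. s \<in> {1..N} \<Longrightarrow> j \<in> {1..l} \<Longrightarrow> a s j \<noteq> 0) \<Longrightarrow> 0 < \<epsilon> \<Longrightarrow>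
      \<exists>A. window_dense Os A \<and> (\<forall>s\<in>{1..N}. s \<noteq> 1 \<longrightarrow> (\<forall>n\<in>A. \<forall>j\<in>{1..l}.
       (\<forall>G. finite G \<and> G \<subseteq> {m \<in> A. n < m} \<longrightarrow> (\<Sum>m\<in>G. norm (weight_prod (w s) (j + m - n) n) powr p /
          norm (weight_prod (w 1) j m) powr p) \<le> \<epsilon>) \<and>
       norm (weight_prod (w s) j n / weight_prod (w 1) j n - a s j / a 1 j) \<le> \<epsilon>))"
  shows "disjoint_hypercyclic {A. window_dense Os A} (lp_topology p) N (\<lambda>s. weighted_shift (w s))"
proof -
  obtain D :: "'a set" where D: "countable D" "0 \<notin> D" "\<And>v e. 0 < e \<Longrightarrow> \<exists>d\<in>D. norm (d - v) < e"
    using countable_dense_nonzero by blast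
  define U where "U = (SIGMA l:{1::nat..}. (UNIV :: nat set) \<times> PiE ({1..N} \<times> {1..l}) (\<lambda>_. D))"
  have "countable U"
    unfolding U_def using D(1) by (intro countable_SIGMA countable_PiE) auto
  obtain d where "d \<in> D" using D(3)[of 1 0] by auto
  then have "(1, 0, \<lambda>t\<in>{1..N} \<times> {1..1}. d) \<in> U"
    by (auto simp: U_def)
  then have "U \<noteq> {}" by blast
  \<comment> \<open>The set \<open>B\<close> of return times for one target, with the constant \<open>\<delta>\<close> of its windows.\<close>
  define good where "good = (\<lambda>u B \<delta>. 0 < \<delta> \<and> B \<subseteq> {1..} \<and>
      (\<forall>K L. \<exists>M\<ge>K. \<exists>k\<in>Os. \<delta> * real M \<le> real (card (B \<inter> {L..} \<inter> {k+1..k+M}))) \<and>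
      (\<forall>n\<in>B. \<forall>m\<in>B. n < m \<longrightarrow> n + fst u < m) \<and> (\<forall>n\<in>B. \<forall>s\<in>{1..N}.
      (\<Sum>j=1..fst u. norm (weight_prod (w s) j n * (snd (snd u) (1, j) / weight_prod (w 1) j n) - snd (snd u) (s, j)) powr p)
         \<le> 1 / real (Suc (fst (snd u))) \<and>
      (\<forall>G. finite G \<and> G \<subseteq> {m \<in> B. n < m} \<longrightarrow>
        (\<Sum>m\<in>G. \<Sum>j=1..fst u. norm (weight_prod (w s) (j + m - n) n * (snd (snd u) (1, j) / weight_prod (w 1) j m)) powr p)
          \<le> 1 / real (Suc (fst (snd u))))))"
  have "\<exists>B \<delta>. good u B \<delta>"
    if u: "u \<in> U" for u
  proof -
    have l: "1 \<le> fst u" using u by (auto simp: U_def)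
    have a: "snd (snd u) (s, j) \<noteq> 0" if "s \<in> {1..N}" "j \<in> {1..fst u}" for s j
    proof -
      have "snd (snd u) (s, j) \<in> D" using u that by (auto simp: U_def PiE_mem)
      then show ?thesis using D(2) by auto
    qed
    obtain B where B: "window_dense Os B"
      "(\<forall>n\<in>B. \<forall>m\<in>B. n < m \<longrightarrow> n + fst u < m) \<and> (\<forall>n\<in>B. \<forall>s\<in>{1..N}.
      (\<Sum>j=1..fst u. norm (weight_prod (w s) j n * (snd (snd u) (1, j) / weight_prod (w 1) j n) - snd (snd u) (s, j)) powr p)
         \<le> 1 / real (Suc (fst (snd u))) \<and>
      (\<forall>G. finite G \<and> G \<subseteq> {m \<in> B. n < m} \<longrightarrow>
        (\<Sum>m\<in>G. \<Sum>j=1..fst u. norm (weight_prod (w s) (j + m - n) n * (snd (snd u) (1, j) / weight_prod (w 1) j m)) powr p)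
          \<le> 1 / real (Suc (fst (snd u)))))"
      using single_target_return_set[of p w "fst u" "\<lambda>s j. snd (snd u) (s, j)" "1 / real (Suc (fst (snd u)))" Os N,
          OF p nz sm a _ comp[OF l a]] N by auto
    obtain \<delta> where "0 < \<delta>" "\<And>K L. \<exists>M\<ge>K. \<exists>k\<in>Os. \<delta> * real M \<le> real (card (B \<inter> {L..} \<inter> {k+1..k+M}))"
      using window_dense_beyond[OF B(1)] by metis
    then show ?thesis
      using B unfolding good_def by (intro exI[of _ B] exI[of _ \<delta>]) (auto simp only: window_dense_def)
  qed
  then obtain B \<delta> where good: "\<And>u. u \<in> U \<Longrightarrow> good u (B u) (\<delta> u)"
    by metis
  note good = good[unfolded good_def]
  have \<delta>: "\<And>u. u \<in> U \<Longrightarrow> 0 < \<delta> u"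
    using good by blast
  have B1: "\<And>u. u \<in> U \<Longrightarrow> B u \<subseteq> {1..}"
    using good by blast
  have dense: "\<And>u K L. u \<in> U \<Longrightarrow> \<exists>M\<ge>K. \<exists>k\<in>Os. \<delta> u * real M \<le> real (card (B u \<inter> {L..} \<inter> {k+1..k+M}))"
    using good by blast
  have gap: "\<And>u n m. u \<in> U \<Longrightarrow> n \<in> B u \<Longrightarrow> m \<in> B u \<Longrightarrow> n < m \<Longrightarrow> n + fst u < m"
    using good by blast
  have diag: "\<And>u n s. u \<in> U \<Longrightarrow> n \<in> B u \<Longrightarrow> s \<in> {1..N} \<Longrightarrow>
      (\<Sum>j=1..fst u. norm (weight_prod (w s) j n * (snd (snd u) (1, j) / weight_prod (w 1) j n) - snd (snd u) (s, j)) powr p)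
         \<le> 1 / real (Suc (fst (snd u)))"
    using good by blast
  have off: "\<And>u n s G. u \<in> U \<Longrightarrow> n \<in> B u \<Longrightarrow> s \<in> {1..N} \<Longrightarrow> finite G \<Longrightarrow> G \<subseteq> {m \<in> B u. n < m} \<Longrightarrow>
        (\<Sum>m\<in>G. \<Sum>j=1..fst u. norm (weight_prod (w s) (j + m - n) n * (snd (snd u) (1, j) / weight_prod (w 1) j m)) powr p)
          \<le> 1 / real (Suc (fst (snd u)))"
    using good by blast
  \<comment> \<open>Each target is selected by all pairs with a given first component, hence infinitely often.\<close>
  define \<kappa> where "\<kappa> = (\<lambda>i. from_nat_into U (fst (prod_decode i)))"
  have \<kappa>U: "\<kappa> i \<in> U" for i
    using \<open>U \<noteq> {}\<close> by (simp add: \<kappa>_def from_nat_into)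
  have often: "\<exists>i\<ge>K. \<kappa> i = u" if u: "u \<in> U" for u K
  proof -
    obtain n where "from_nat_into U n = u"
      using from_nat_into_surj[OF \<open>countable U\<close> u] by blast
    then show ?thesis
      by (intro exI[of _ "prod_encode (n, K)"]) (simp add: \<kappa>_def le_prod_encode_2)
  qed
  obtain C0 where C0: "\<And>s n. s \<in> {1..N} \<Longrightarrow> 1 \<le> n \<Longrightarrow> norm (w s n) \<le> C0"
  proof -
    have "bounded (\<Union>s\<in>{1..N}. w s ` {1..})"
      using w by (intro bounded_UN) auto
    then show thesis
      using that unfolding bounded_iff by blast
  qed
  define C where "C = max 1 C0"
  have C: "1 \<le> C" "\<And>s n. s \<in> {1..N} \<Longrightarrow> 1 \<le> n \<Longrightarrow> norm (w s n) \<le> C"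
    using C0 by (force simp: C_def)+
  define l where "l = (\<lambda>i. fst (\<kappa> i))"
  define c where "c = (\<lambda>i m j. snd (snd (\<kappa> i)) (1, j) / weight_prod (w 1) j m)"
  define Y where "Y = (\<lambda>i s q. if q \<in> {1..l i} then snd (snd (\<kappa> i)) (s, q) else 0)"
  define \<tau> where "\<tau> = (\<lambda>i. 1 / real (Suc (fst (snd (\<kappa> i)))))"
  define f where "f = (\<lambda>i m. \<Sum>j=1..l i. norm (c i m j) powr p)"
  have f: "summable (f i)" "0 \<le> f i m" for i m
  proof -
    have "summable (\<lambda>m. norm (snd (snd (\<kappa> i)) (1, j)) powr p * (1 / norm (weight_prod (w 1) j m) powr p))"
      if "j \<in> {1..l i}" for j
      using that by (intro summable_mult sm) auto
    then show "summable (f i)"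
      unfolding f_def by (intro summable_sum) (auto simp: c_def norm_divide powr_divide)
  qed (simp add: f_def sum_nonneg)
  have Cp: "1 \<le> C powr p" using C(1) p by (simp add: ge_one_powr_ge_zero)
  obtain E P where E: "\<And>i. E i \<subseteq> B (\<kappa> i)" "\<And>i. finite (E i)"
    "\<And>i. \<exists>M\<ge>i. \<exists>k\<in>Os. \<delta> (\<kappa> i) * real M \<le> real (card (E i \<inter> {k+1..k+M}))"
    and P: "\<And>i m. m \<in> E i \<Longrightarrow> m + l i < P i" "\<And>i. E (Suc i) \<subseteq> {P i..}" "\<And>i. P i \<le> P (Suc i)"
    "\<And>i. (C powr p) ^ P i * (\<Sum>m\<in>E (Suc i). f (Suc i) m) \<le> (1/2) ^ Suc i"
    by (rule separated_windows[of Os "\<lambda>i. \<delta> (\<kappa> i)" "\<lambda>i. B (\<kappa> i)" f "C powr p" l, OF dense[OF \<kappa>U] f Cp])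
      (rule that)
  have gapE: "n + l i < m" if "m \<in> E i" "n \<in> E i" "n < m" for i m n
    using gap[OF \<kappa>U, of n i m] E(1) that by (auto simp: l_def)
  have diagE: "(\<Sum>j=1..l i. norm (weight_prod (w s) j n * c i n j - Y i s j) powr p) \<le> \<tau> i"
    if "n \<in> E i" "s \<in> {1..N}" for i n s
  proof -
    have "(\<Sum>j=1..l i. norm (weight_prod (w s) j n * c i n j - Y i s j) powr p) =
      (\<Sum>j=1..l i. norm (weight_prod (w s) j n * c i n j - snd (snd (\<kappa> i)) (s, j)) powr p)"
      by (intro sum.cong) (auto simp: Y_def)
    then show ?thesis
      using diag[OF \<kappa>U, of n i s] E(1) that by (auto simp: l_def c_def \<tau>_def)
  qed
  have offE: "(\<Sum>m\<in>{m \<in> E i. n < m}. \<Sum>j=1..l i. norm (weight_prod (w s) (j + m - n) n * c i m j) powr p) \<le> \<tau> i"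
    if "n \<in> E i" "s \<in> {1..N}" for i n s
    unfolding l_def c_def \<tau>_def using E(1,2)[of i] that by (intro off \<kappa>U) auto
  have Y0: "Y i s q = 0" if "q \<notin> {1..l i}" for i s q
    using that by (auto simp: Y_def)
  obtain x where x: "x \<in> lp p" and
    close: "\<And>i n s F. n \<in> E i \<Longrightarrow> s \<in> {1..N} \<Longrightarrow> finite F \<Longrightarrow> F \<subseteq> {1..} \<Longrightarrow>
      (\<Sum>q\<in>F. norm ((weighted_shift (w s) ^^ n) x q - Y i s q) powr p) \<le> 2 * \<tau> i + (1/2) ^ i"
    by (rule vector_from_windows[where N = N and y = Y and \<tau> = \<tau> and c = c and l = l,
          OF p C E(2) gapE P(1-3) P(4)[unfolded f_def] Y0 diagE offE])
      (assumption | rule that)+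
  show ?thesis
  proof (rule disjoint_hypercyclicI[OF p x])
    show "B \<in> {A. window_dense Os A}" if "A \<in> {A. window_dense Os A}" "A \<subseteq> B" "B \<subseteq> {1..}" for A B
      using window_dense_mono that by blast
    fix y :: "nat \<Rightarrow> nat \<Rightarrow> 'a" and r :: real
    assume y: "\<And>s. s \<in> {1..N} \<Longrightarrow> y s \<in> lp p" and r: "0 < r"
    obtain l0 a0 where a0: "1 \<le> l0" "a0 \<in> PiE ({1..N} \<times> {1..l0}) (\<lambda>_. D)"
      "\<And>s. s \<in> {1..N} \<Longrightarrow> lp_norm p (\<lambda>q. (if q \<in> {1..l0} then a0 (s, q) else 0) - y s q) \<le> r / 3"
      using lp_approx_finite_support[of p N y D "r / 3", OF p y D(3)] r by auto
    define \<rho> where "\<rho> = (r / 3) powr p"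
    have \<rho>: "0 < \<rho>" using r by (simp add: \<rho>_def)
    \<comment> \<open>Half of \<open>\<rho>\<close> is spent on the tolerance of the target, half on the windows after the current one.\<close>
    obtain q0 where q0: "1 / real (Suc q0) < \<rho> / 4"
      using nat_approx_posE[of "\<rho> / 4"] \<rho> by auto
    obtain i0 where i0: "(1/2::real) ^ i0 < \<rho> / 2"
      using real_arch_pow_inv[of "\<rho> / 2" "1/2"] \<rho> by auto
    define u where "u = (l0, q0, a0)"
    have u: "u \<in> U" using a0 by (simp add: u_def U_def)
    define A where "A = (\<Union>i\<in>{i. i0 \<le> i \<and> \<kappa> i = u}. E i)"
    have A1: "A \<subseteq> {1..}"
      using E(1) B1[OF u] by (force simp: A_def)
    have "\<exists>M\<ge>K. \<exists>k\<in>Os. \<delta> u * real M \<le> real (card (A \<inter> {k+1..k+M}))" for K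
    proof -
      obtain i where i: "i \<ge> max K i0" "\<kappa> i = u" using often[OF u] by blast
      obtain M k where M: "M \<ge> i" "k \<in> Os" "\<delta> u * real M \<le> real (card (E i \<inter> {k+1..k+M}))"
        using E(3)[of i] i by auto
      have "card (E i \<inter> {k+1..k+M}) \<le> card (A \<inter> {k+1..k+M})"
        using i by (intro card_mono) (auto simp: A_def)
      then have "\<delta> u * real M \<le> real (card (A \<inter> {k+1..k+M}))"
        using M(3) by linarith
      then show ?thesis using M i by (meson max.boundedE order_trans)
    qed
    then have "window_dense Os A"
      using \<delta>[OF u] A1 by (auto simp: window_dense_def)
    moreover have "(weighted_shift (w s) ^^ n) x \<in> lp p \<and> lp_dist p (y s) ((weighted_shift (w s) ^^ n) x) < r"
      if n: "n \<in> A" and s: "s \<in> {1..N}" for n s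
    proof
      show Tx: "(weighted_shift (w s) ^^ n) x \<in> lp p"
        by (rule weighted_shift_power_in_lp[OF p w[OF s] x])
      obtain i where i: "i0 \<le> i" "\<kappa> i = u" "n \<in> E i"
        using n by (auto simp: A_def)
      have Y: "Y i s = (\<lambda>q. if q \<in> {1..l0} then a0 (s, q) else 0)" "\<tau> i = 1 / real (Suc q0)"
        using i(2) by (auto simp: Y_def l_def u_def \<tau>_def)
      let ?z = "\<lambda>q. (weighted_shift (w s) ^^ n) x q - Y i s q"
      have "(1/2::real) ^ i \<le> (1/2) ^ i0"
        using i(1) by (intro power_decreasing) auto
      then have "2 * \<tau> i + (1/2) ^ i \<le> \<rho>"
        using q0 i0 Y(2) by linarith
      then have bound: "(\<Sum>q\<in>F. norm (?z q) powr p) \<le> \<rho>" if "finite F" "F \<subseteq> {1..}" for F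
        using close[OF i(3) s that] by linarith
      have z0: "?z 0 = 0"
        using Tx by (simp add: lp_def Y)
      have "lp_norm p ?z \<le> \<rho> powr (1 / p)"
        by (rule lp_bounded_sumsI(2)[OF p z0 bound])
      also have "\<dots> = r / 3"
        using r p by (simp add: \<rho>_def powr_powr)
      finally have z: "lp_norm p ?z \<le> r / 3" .
      have "(\<lambda>q. ?z q + (Y i s q - y s q)) = (\<lambda>q. (weighted_shift (w s) ^^ n) x q - y s q)"
        by auto
      moreover have "(\<lambda>q. Y i s q - y s q) \<in> lp p"
        by (intro lp_diff_closed[OF p _ y[OF s]] finite_support_in_lp[of _ l0]) (auto simp: Y)
      ultimately have "lp_norm p (\<lambda>q. (weighted_shift (w s) ^^ n) x q - y s q) \<le> lp_norm p ?z + lp_norm p (\<lambda>q. Y i s q - y s q)"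
        using lp_add_le(2)[OF p lp_bounded_sumsI(1)[OF p z0 bound], of "\<lambda>q. Y i s q - y s q"] by simp
      also have "\<dots> \<le> r / 3 + r / 3"
        using a0(3)[OF s] z by (intro add_mono) (auto simp: Y)
      finally have "lp_dist p ((weighted_shift (w s) ^^ n) x) (y s) \<le> r / 3 + r / 3"
        by (simp add: lp_dist_def)
      moreover have "lp_dist p (y s) ((weighted_shift (w s) ^^ n) x) = lp_dist p ((weighted_shift (w s) ^^ n) x) (y s)"
        by (simp add: lp_dist_def lp_norm_def norm_minus_commute)
      ultimately show "lp_dist p (y s) ((weighted_shift (w s) ^^ n) x) < r"
        using r by linarith
    qed
    ultimately show "\<exists>A\<in>{A. window_dense Os A}. A \<subseteq> {1..} \<and>
        (\<forall>n\<in>A. \<forall>s\<in>{1..N}. (weighted_shift (w s) ^^ n) x \<in> lp p \<and> lp_dist p (y s) ((weighted_shift (w s) ^^ n) x) < r)"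
      using A1 by blast
  qed
qed

section \<open>The characterization\<close>

theorem theorem3p7:
  fixes w :: "nat \<Rightarrow> nat \<Rightarrow> 'a::{real_normed_field, euclidean_space}"
    and N :: nat and p :: real and \<A> :: "nat set set"
  assumes "2 \<le> N" and "1 \<le> p"
    and "\<forall>s\<in>{1..N}. bounded (w s ` {1..})"
    and "\<A> = family_uBd \<or> \<A> = family_ud"
  shows "disjoint_hypercyclic \<A> (lp_topology p) N (\<lambda>s. weighted_shift (w s)) \<longleftrightarrow>
    (\<forall>j\<ge>1. \<forall>s\<in>{1..N}. (\<Sum>\<^sub>\<infinity>n\<in>{1..}. 1 / ennreal (norm (weight_prod (w s) j n) powr p)) < \<infinity>) \<and>
    (\<forall>l\<ge>1. \<forall>a :: nat \<Rightarrow> nat \<Rightarrow> 'a. (\<forall>s\<in>{1..N}. \<forall>j\<in>{1..l}. a s j \<noteq> 0) \<longrightarrow>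
      (\<forall>\<epsilon>>0. \<exists>A\<in>\<A>. \<forall>s\<in>{1..N}. \<forall>t\<in>{1..N}. s \<noteq> t \<longrightarrow> (\<forall>n\<in>A.
        (\<forall>j\<in>{1..l}. (\<Sum>\<^sub>\<infinity>m\<in>{m \<in> A. m > n}.
            ennreal (norm (weight_prod (w s) (j + m - n) n) powr p) /
            ennreal (norm (weight_prod (w t) j m) powr p)) \<le> ennreal \<epsilon>) \<and>
        (\<forall>j\<in>{1..l}. norm (weight_prod (w s) j n / weight_prod (w t) j n - a s j / a t j) \<le> \<epsilon>))))"
    (is "?hyp \<longleftrightarrow> ?sums \<and> ?comp")
proof -
  obtain Os where Os: "\<A> = {A. window_dense Os A}"
    using assms(4) family_ud_eq_window_dense family_uBd_eq_window_dense by blast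
  have N: "1 \<le> N" and w: "\<And>s. s \<in> {1..N} \<Longrightarrow> bounded (w s ` {1..})"
    using assms by auto
  show ?thesis
  proof
    assume ?hyp
    then obtain x where x: "x \<in> lp p"
      and ret: "\<And>y r. (\<And>s. s \<in> {1..N} \<Longrightarrow> y s \<in> lp p) \<Longrightarrow> 0 < r \<Longrightarrow>
      {n. 1 \<le> n \<and> (\<forall>s\<in>{1..N}. (weighted_shift (w s) ^^ n) x \<in> lp p \<and> lp_dist p (y s) ((weighted_shift (w s) ^^ n) x) < r)} \<in> \<A>"
      using disjoint_hypercyclicD[OF assms(2)] by blast
    have ret': "window_dense Os {n. 1 \<le> n \<and> (\<forall>s\<in>{1..N}. lp_dist p (y s) ((weighted_shift (w s) ^^ n) x) < r)}"
      if "\<And>s. s \<in> {1..N} \<Longrightarrow> y s \<in> lp p" "0 < r" for y r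
      by (rule window_dense_mono[OF ret[OF that, unfolded Os mem_Collect_eq]]) auto
    have ?sums
    proof (intro allI impI ballI)
      fix j s assume j: "1 \<le> (j::nat)" and s: "s \<in> {1..N}"
      have "window_dense Os {n. 1 \<le> n \<and> (\<forall>s\<in>{1..N}. lp_dist p (canonical_basis j) ((weighted_shift (w s) ^^ n) x) < 1/2)}"
        by (rule ret') (use canonical_basis_in_lp[OF j] in auto)
      from returns_imp_summable_inverse_weights[OF assms(2) w[OF s] x j this] s
      show "(\<Sum>\<^sub>\<infinity>n\<in>{1..}. 1 / ennreal (norm (weight_prod (w s) j n) powr p)) < \<infinity>"
        unfolding infsum_inverse_weights_finite_iff by blast
    qed
    moreover have ?comp
    proof (intro allI impI)
      fix l and a :: "nat \<Rightarrow> nat \<Rightarrow> 'a" and \<epsilon> :: real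
      assume l: "1 \<le> l" and a: "\<forall>s\<in>{1..N}. \<forall>j\<in>{1..l}. a s j \<noteq> 0" and \<epsilon>: "0 < \<epsilon>"
      have "\<exists>A. window_dense Os A \<and> (\<forall>s\<in>{1..N}. \<forall>t\<in>{1..N}. \<forall>n\<in>A. \<forall>j\<in>{1..l}.
          (\<Sum>\<^sub>\<infinity>m\<in>{m \<in> A. m > n}. ennreal (norm (weight_prod (w s) (j + m - n) n) powr p) /
            ennreal (norm (weight_prod (w t) j m) powr p)) \<le> ennreal \<epsilon> \<and>
          norm (weight_prod (w s) j n / weight_prod (w t) j n - a s j / a t j) \<le> \<epsilon>)"
        using a by (intro returns_imp_comparison[OF assms(2) w x N l _ \<epsilon> ret']) auto
      then obtain A where "window_dense Os A" and A: "\<forall>s\<in>{1..N}. \<forall>t\<in>{1..N}. \<forall>n\<in>A. \<forall>j\<in>{1..l}.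
          (\<Sum>\<^sub>\<infinity>m\<in>{m \<in> A. m > n}. ennreal (norm (weight_prod (w s) (j + m - n) n) powr p) /
            ennreal (norm (weight_prod (w t) j m) powr p)) \<le> ennreal \<epsilon> \<and>
          norm (weight_prod (w s) j n / weight_prod (w t) j n - a s j / a t j) \<le> \<epsilon>"
        by blast
      then have "A \<in> \<A>" by (simp add: Os)
      then show "\<exists>A\<in>\<A>. \<forall>s\<in>{1..N}. \<forall>t\<in>{1..N}. s \<noteq> t \<longrightarrow> (\<forall>n\<in>A.
        (\<forall>j\<in>{1..l}. (\<Sum>\<^sub>\<infinity>m\<in>{m \<in> A. m > n}.
            ennreal (norm (weight_prod (w s) (j + m - n) n) powr p) /
            ennreal (norm (weight_prod (w t) j m) powr p)) \<le> ennreal \<epsilon>) \<and>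
        (\<forall>j\<in>{1..l}. norm (weight_prod (w s) j n / weight_prod (w t) j n - a s j / a t j) \<le> \<epsilon>))"
        using A by (intro bexI[of _ A]) auto
    qed
    ultimately show "?sums \<and> ?comp" ..
  next
    assume "?sums \<and> ?comp"
    then have sums: ?sums and comp: ?comp by blast+
    have W: "weight_prod (w s) j n \<noteq> 0" "summable (\<lambda>n. 1 / norm (weight_prod (w s) j n) powr p)"
      if "s \<in> {1..N}" "1 \<le> j" for s j n
      using sums that unfolding infsum_inverse_weights_finite_iff by blast+
    show ?hyp
      unfolding Os
    proof (rule disjoint_hypercyclic_of_comparison[OF assms(2) N w])
      fix l and a :: "nat \<Rightarrow> nat \<Rightarrow> 'a" and \<epsilon> :: real
      assume l: "1 \<le> l" and a: "\<And>s j. s \<in> {1..N} \<Longrightarrow> j \<in> {1..l} \<Longrightarrow> a s j \<noteq> 0" and \<epsilon>: "0 < \<epsilon>"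
      have "\<exists>A\<in>\<A>. \<forall>s\<in>{1..N}. \<forall>t\<in>{1..N}. s \<noteq> t \<longrightarrow> (\<forall>n\<in>A.
        (\<forall>j\<in>{1..l}. (\<Sum>\<^sub>\<infinity>m\<in>{m \<in> A. m > n}.
            ennreal (norm (weight_prod (w s) (j + m - n) n) powr p) /
            ennreal (norm (weight_prod (w t) j m) powr p)) \<le> ennreal \<epsilon>) \<and>
        (\<forall>j\<in>{1..l}. norm (weight_prod (w s) j n / weight_prod (w t) j n - a s j / a t j) \<le> \<epsilon>))"
        using comp l a \<epsilon> by blast
      then obtain A where A: "A \<in> \<A>" and all: "\<forall>s\<in>{1..N}. \<forall>t\<in>{1..N}. s \<noteq> t \<longrightarrow> (\<forall>n\<in>A.
        (\<forall>j\<in>{1..l}. (\<Sum>\<^sub>\<infinity>m\<in>{m \<in> A. m > n}.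
            ennreal (norm (weight_prod (w s) (j + m - n) n) powr p) /
            ennreal (norm (weight_prod (w t) j m) powr p)) \<le> ennreal \<epsilon>) \<and>
        (\<forall>j\<in>{1..l}. norm (weight_prod (w s) j n / weight_prod (w t) j n - a s j / a t j) \<le> \<epsilon>))"
        by blast
      have "1 \<in> {1..N}" using N by simp
      then have both: "(\<Sum>\<^sub>\<infinity>m\<in>{m \<in> A. m > n}. ennreal (norm (weight_prod (w s) (j + m - n) n) powr p) /
            ennreal (norm (weight_prod (w 1) j m) powr p)) \<le> ennreal \<epsilon> \<and>
          norm (weight_prod (w s) j n / weight_prod (w 1) j n - a s j / a 1 j) \<le> \<epsilon>"
        if "s \<in> {1..N}" "s \<noteq> 1" "n \<in> A" "j \<in> {1..l}" for s n j
        using all that by blast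
      have "(\<Sum>m\<in>G. norm (weight_prod (w s) (j + m - n) n) powr p / norm (weight_prod (w 1) j m) powr p) \<le> \<epsilon>"
        if "s \<in> {1..N}" "s \<noteq> 1" "n \<in> A" "j \<in> {1..l}" "finite G" "G \<subseteq> {m \<in> A. n < m}" for s n j G
        using both[OF that(1-4)] that W(1)[of 1 j] N \<epsilon>
        by (intro infsum_ennreal_le_imp_finite_sums_le[where S = "{m \<in> A. n < m}"]) auto
      with A both show "\<exists>A. window_dense Os A \<and> (\<forall>s\<in>{1..N}. s \<noteq> 1 \<longrightarrow> (\<forall>n\<in>A. \<forall>j\<in>{1..l}.
       (\<forall>G. finite G \<and> G \<subseteq> {m \<in> A. n < m} \<longrightarrow> (\<Sum>m\<in>G. norm (weight_prod (w s) (j + m - n) n) powr p /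
          norm (weight_prod (w 1) j m) powr p) \<le> \<epsilon>) \<and>
       norm (weight_prod (w s) j n / weight_prod (w 1) j n - a s j / a 1 j) \<le> \<epsilon>))"
        unfolding Os by (intro exI[of _ A]) auto
    qed (use W N in auto)
  qed
qed

end
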